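(* For each $k\in\mathbb Z\setminus\{0\}$ the following hold (with $z=\Psi(w)$). (a) Continuity of $\mathcal C_1[\varphi_k]$: $\mathcal C_1[\varphi_k]\big|^+_{\partial\Omega}=\mathcal C_1[\varphi_k]\big|^-_{\partial\Omega}$. (b) Cancellation of the terms involving $\mathcal C_2[\varphi_k]$: $$-\Psi(w)\,\overline{\mathcal C_2[\varphi_k](z)}+\overline{\mathcal C_2[\overline\zeta\varphi_k](z)}\to0\quad\text{as }z\to\partial\Omega,$$ where the limit is taken from both the exterior and the interior of $\Omega$. (c) Reduction of the full combination to the $\mathcal C_1$ part: $$\Big(-\Psi(w)\,\overline{\mathcal C[\varphi_k](z)}+\overline{\mathcal C[\overline\zeta\varphi_k](z)}\Big)\Big|^{\pm}_{\partial\Omega}=\Big(-\Psi(w)\,\overline{\mathcal C_1[\varphi_k](z)}+\overline{\mathcal C_1[\overline\zeta\varphi_k](z)}\Big)\Big|_{\partial\Omega}.$$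
   Context: $\Omega\subset\mathbb C$ is a bounded simply connected domain with analytic boundary; $\gamma>0$ is its conformal radius and $\Psi$ is the unique conformal map of $\{|w|>\gamma\}$ onto $\mathbb C\setminus\overline\Omega$ of the form $\Psi(w)=w+a_0+a_1w^{-1}+\cdots$; analyticity of $\partial\Omega$ means $\Psi$ extends conformally to $|w|>\gamma-\delta$ for some $\delta>0$. Put $a_{-1}=1$. Points on or near $\partial\Omega$ (on both sides) are written $z=\Psi(w)$, with $|w|=\gamma$ on $\partial\Omega$. Superscripts $+$/$-$ denote limits at $\partial\Omega$ from outside/inside $\Omega$. For $z=\Psi(\gamma e^{i\theta})\in\partial\Omega$ and $k\in\mathbb Z$, $\varphi_k(z)=e^{ik\theta}/h(\theta)$ with $h(\theta)=\gamma|\Psi'(\gamma e^{i\theta})|$. Faber polynomials $F_m$: $\frac{w\Psi'(w)}{\Psi(w)-z}=\sum_{m\ge0}F_m(z)w^{-m}$ for $|w|>\gamma$, $z\in\overline\Omega$. For a density $\varphi$ on $\partial\Omega$ and $z\notin\partial\Omega$, $$\mathcal C[\varphi](z)=\frac1{2\pi}\int_{\partial\Omega}\frac{\varphi(\zeta)}{z-\zeta}\,d\sigma(\zeta),\qquad \mathcal C[\overline\zeta\varphi](z)=\frac1{2\pi}\int_{\partial\Omega}\frac{\overline\zeta\,\varphi(\zeta)}{z-\zeta}\,d\sigma(\zeta).$$ Decomposition $\mathcal C[\varphi_k]=\mathcal C_1[\varphi_k]+\mathcal C_2[\varphi_k]$: for $n\ge1$, $\mathcal C_1[\varphi_n](z)=-\frac1n\gamma^{-n}F_n'(z)$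 and $\mathcal C_1[\varphi_{-n}](z)=0$; also $\mathcal C_1[\varphi_0]=0$. For $k\in\mathbb Z$, $\mathcal C_2[\varphi_k](z)=0$ for $z\in\Omega$ and $\mathcal C_2[\varphi_k](z)=\gamma^{-k}w^{k-1}\frac1{\Psi'(w)}$ for $z=\Psi(w)\in\mathbb C\setminus\overline\Omega$. Correspondingly (from $\overline\zeta=\sum_{j\ge-1}\overline{a_j}\gamma^{-j}e^{ij\theta}$ on $\partial\Omega$), for $s=1,2$ and $z$ near $\partial\Omega$, $$\mathcal C_s[\overline\zeta\varphi_k](z)=\sum_{j=-1}^\infty\overline{a_j}\,\gamma^{-j}\,\mathcal C_s[\varphi_{k+j}](z).$$ *)

theory Defs
  imports "HOL-Complex_Analysis.Complex_Analysis"
begin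

text \<open>
  Throughout, \<open>\<Psi>\<close> is the exterior conformal map (extended slightly across the circle of radius
  \<open>\<gamma>\<close>), the boundary curve is \<open>\<theta> \<mapsto> \<Psi> (\<gamma> e\<^sup>i\<^sup>\<theta>)\<close>, and \<open>a :: int \<Rightarrow> complex\<close> holds the coefficients
  \<open>a\<^sub>j\<close>, \<open>j \<ge> -1\<close>, of \<open>\<Psi> w = (\<Sum>j\<ge>-1. a\<^sub>j w\<^sup>-\<^sup>j)\<close>. Sums over \<open>j \<ge> -1\<close> are written as series in
  \<open>i :: nat\<close> with \<open>j = int i - 1\<close>.
\<close>

definition bdry_curve :: "real \<Rightarrow> (complex \<Rightarrow> complex) \<Rightarrow> real \<Rightarrow> complex" where
  "bdry_curve \<gamma> \<Psi> \<theta> = \<Psi> (of_real \<gamma> * cis \<theta>)"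

text \<open>Integral of \<open>f\<close> over the curve \<open>p\<close>, parametrised by \<open>[0, 2\<pi>]\<close>, with respect to arc length.\<close>

definition arclength_integral :: "(real \<Rightarrow> complex) \<Rightarrow> (complex \<Rightarrow> complex) \<Rightarrow> complex" where
  "arclength_integral p f =
     integral {0..2 * pi} (\<lambda>\<theta>. f (p \<theta>) * of_real (norm (vector_derivative p (at \<theta>))))"

definition cauchy_op ::
    "real \<Rightarrow> (complex \<Rightarrow> complex) \<Rightarrow> (complex \<Rightarrow> complex) \<Rightarrow> complex \<Rightarrow> complex" where
  "cauchy_op \<gamma> \<Psi> \<phi> z =
     1 / (2 * of_real pi) * arclength_integral (bdry_curve \<gamma> \<Psi>) (\<lambda>\<zeta>. \<phi> \<zeta> / (z - \<zeta>))"

definition scale_h :: "real \<Rightarrow> (complex \<Rightarrow> complex) \<Rightarrow> real \<Rightarrow> real" where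
  "scale_h \<gamma> \<Psi> \<theta> = \<gamma> * norm (deriv \<Psi> (of_real \<gamma> * cis \<theta>))"

text \<open>
  The angle \<open>\<theta>\<close> of a boundary point \<open>z = \<Psi> (\<gamma> e\<^sup>i\<^sup>\<theta>)\<close> is normalised by \<open>Arg\<close>; the value does not depend
  on this choice because \<open>k\<close> is an integer. Points off the boundary get an irrelevant value.
\<close>

definition basis_density ::
    "real \<Rightarrow> (complex \<Rightarrow> complex) \<Rightarrow> int \<Rightarrow> complex \<Rightarrow> complex" where
  "basis_density \<gamma> \<Psi> k z =
     (let \<theta> = Arg (inv_into (sphere 0 \<gamma>) \<Psi> z)
      in cis (of_int k * \<theta>) / of_real (scale_h \<gamma> \<Psi> \<theta>))"

text \<open>
  For an infinite set \<open>\<Omega>\<close> the generating function determines the polynomials \<open>F m\<close> uniquely.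
\<close>

definition faber_polynomials ::
    "complex set \<Rightarrow> real \<Rightarrow> (complex \<Rightarrow> complex) \<Rightarrow> (nat \<Rightarrow> complex poly) \<Rightarrow> bool" where
  "faber_polynomials \<Omega> \<gamma> \<Psi> F \<longleftrightarrow>
     (\<forall>z\<in>closure \<Omega>. \<forall>w. norm w > \<gamma> \<longrightarrow>
        (\<lambda>m. poly (F m) z * w powi (- int m)) sums (w * deriv \<Psi> w / (\<Psi> w - z)))"

text \<open>\<open>C1_phi \<gamma> F k\<close> and \<open>C2_phi \<Omega> \<gamma> \<Psi> k\<close> are the two parts of the Cauchy transform of \<open>\<phi>\<^sub>k\<close>.\<close>

definition C1_phi :: "real \<Rightarrow> (nat \<Rightarrow> complex poly) \<Rightarrow> int \<Rightarrow> complex \<Rightarrow> complex" where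
  "C1_phi \<gamma> F k z =
     (if k > 0
      then - (1 / of_int k) * of_real \<gamma> powi (- k) * poly (pderiv (F (nat k))) z
      else 0)"

text \<open>
  In the exterior, \<open>w\<close> is the point with \<open>z = \<Psi> w\<close>, \<open>\<bar>w\<bar> > \<gamma>\<close>. The value \<open>0\<close> on the boundary itself is
  a convention that is never used.
\<close>

definition C2_phi ::
    "complex set \<Rightarrow> real \<Rightarrow> (complex \<Rightarrow> complex) \<Rightarrow> int \<Rightarrow> complex \<Rightarrow> complex" where
  "C2_phi \<Omega> \<gamma> \<Psi> k z =
     (if z \<in> - closure \<Omega>
      then (let w = inv_into {w. norm w > \<gamma>} \<Psi> z
            in of_real \<gamma> powi (- k) * w powi (k - 1) * (1 / deriv \<Psi> w))
      else 0)"

text \<open>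
  Applied to \<open>Cs k =\<close> the \<open>s\<close>-th part for the density \<open>\<phi>\<^sub>k\<close>, this is the \<open>s\<close>-th part for \<open>\<zeta> \<mapsto> cnj \<zeta> \<phi>\<^sub>k \<zeta>\<close>,
  i.e. \<open>\<Sum>j\<ge>-1. cnj a\<^sub>j \<gamma>\<^sup>-\<^sup>j Cs (k + j) z\<close>. The series is only meant near the boundary, where it converges.
\<close>

definition conj_part ::
    "(int \<Rightarrow> complex) \<Rightarrow> real \<Rightarrow> (int \<Rightarrow> complex \<Rightarrow> complex) \<Rightarrow> int \<Rightarrow> complex \<Rightarrow> complex" where
  "conj_part a \<gamma> Cs k z =
     (\<Sum>i. cnj (a (int i - 1)) * of_real \<gamma> powi (- (int i - 1)) * Cs (k + (int i - 1)) z)"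

text \<open>The filter of \<open>z \<rightarrow> S\<close> (the distance to the set \<open>S\<close> tends to \<open>0\<close>), with \<open>z\<close> ranging over \<open>A\<close>.\<close>

definition approaching :: "complex set \<Rightarrow> complex set \<Rightarrow> complex filter" where
  "approaching S A = inf (filtercomap (\<lambda>z. infdist z S) (nhds 0)) (principal A)"

end

theory Submission
  imports Defs
begin

text \<open>
  Everything is pulled back to the coordinate \<open>w\<close> with \<open>z = \<Psi> w\<close>. There the arc length element cancels
  the factor \<open>h\<close> in \<open>\<phi>\<^sub>k\<close>, and the Cauchy integral of \<open>\<phi>\<^sub>k\<close> becomes
  \<open>-(1/2\<pi>i) \<integral> q w / (\<Psi> w - z) dw\<close> over \<open>\<bar>w\<bar> = \<gamma>\<close> with the kernel \<open>q w = \<gamma>\<^sup>-\<^sup>k w\<^sup>k\<^sup>-\<^sup>1\<close>. For the density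
  \<open>cnj \<zeta> \<phi>\<^sub>k\<close> the kernel is multiplied by the Schwarz function \<open>S w = cnj (\<Psi> (\<gamma>\<^sup>2 / cnj w))\<close>: it equals
  \<open>cnj (\<Psi> w)\<close> on the circle \<open>\<bar>w\<bar> = \<gamma>\<close> and, because \<open>\<Psi>\<close> is analytic on \<open>\<bar>w\<bar> > r\<close> for some \<open>r < \<gamma>\<close>, it is
  holomorphic for \<open>0 < \<bar>w\<bar> < \<gamma>\<^sup>2 / r\<close>. The right-hand end of that range lies beyond \<open>\<gamma>\<close>, so both kernels are holomorphic
  on a neighbourhood of the circle and the contour can be moved out to \<open>\<bar>w\<bar> = R\<close> with
  \<open>\<gamma> < R < \<gamma>\<^sup>2 / r\<close>.

  For \<open>z \<in> \<Omega>\<close> nothing is crossed. For \<open>z = \<Psi> w\<close> with \<open>\<gamma> < \<bar>w\<bar> < R\<close> the pole at \<open>w\<close> is crossed and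
  contributes \<open>q w / \<Psi>' w\<close>. The integral over \<open>\<bar>w\<bar> = R\<close> is holomorphic in \<open>z\<close> on a full
  neighbourhood of \<open>closure \<Omega>\<close>; it is the \<open>C\<^sub>1\<close> part (\<open>C1_phi_eq_cauchy_transform\<close> and
  \<open>conj_part_C1_eq_cauchy_transform\<close>). The crossed pole is the \<open>C\<^sub>2\<close> part. Hence the full combination is
  the sum of the two partial ones on both sides of the boundary (\<open>full_eq_combination_sum\<close>).

  The \<open>C\<^sub>1\<close> combination is continuous across the boundary by holomorphy. The \<open>C\<^sub>2\<close> combination vanishes in
  \<open>\<Omega>\<close>, and outside near the boundary it equals \<open>cnj (q w / \<Psi>' w) (cnj (S w) - \<Psi> w)\<close>, whose second factor tends to \<open>0\<close> as
  \<open>\<bar>w\<bar> \<rightarrow> \<gamma>\<close> because \<open>S = cnj \<Psi>\<close> on the circle. Compactness of the boundary makes this limit uniform.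

  The link between Faber polynomials and the integrals over \<open>\<bar>w\<bar> = R\<close> comes from the generating function: it gives
  \<open>F\<^sub>k z = (1/2\<pi>i) \<integral> w\<^sup>k \<Psi>' w / (\<Psi> w - z) dw\<close> in \<open>\<Omega>\<close>; differentiating in \<open>z\<close> and integrating by parts in \<open>w\<close>
  yields \<open>F\<^sub>k' z = (k/2\<pi>i) \<integral> w\<^sup>k\<^sup>-\<^sup>1 / (\<Psi> w - z) dw\<close>, and the identity theorem carries this across the boundary.
\<close>

section \<open>Integrals over circles centred at the origin\<close>

lemma circlepath_integrable_if_continuous:
  assumes "continuous_on (sphere 0 R) f" "R > 0"
  shows "f contour_integrable_on circlepath 0 R"
  using assms by (intro contour_integrable_continuous_circlepath) auto

lemma circlepath_integral_sums:
  assumes "R > 0" and cont: "\<And>n. continuous_on (sphere 0 R) (f n)"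
    and bound: "\<And>n w. w \<in> sphere 0 R \<Longrightarrow> norm (f n w) \<le> M n" and "summable M"
    and sums: "\<And>w. w \<in> sphere 0 R \<Longrightarrow> (\<lambda>n. f n w) sums g w"
  shows "(\<lambda>n. contour_integral (circlepath 0 R) (f n)) sums contour_integral (circlepath 0 R) g"
proof -
  have int: "f n contour_integrable_on circlepath 0 R" for n
    by (intro circlepath_integrable_if_continuous cont \<open>R > 0\<close>)
  have "uniform_limit (sphere 0 R) (\<lambda>n w. \<Sum>i<n. f i w) (\<lambda>w. \<Sum>i. f i w) sequentially"
    by (rule Weierstrass_m_test[OF bound \<open>summable M\<close>])
  hence "uniform_limit (sphere 0 R) (\<lambda>n w. \<Sum>i<n. f i w) g sequentially"
    by (rule uniform_limit_cong'[THEN iffD1, rotated -1]) (use sums in \<open>auto simp: sums_iff\<close>)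
  hence "(\<lambda>n. contour_integral (circlepath 0 R) (\<lambda>w. \<Sum>i<n. f i w)) \<longlonglongrightarrow>
           contour_integral (circlepath 0 R) g"
    by (intro contour_integral_uniform_limit_circlepath(2))
       (auto intro!: contour_integrable_sum always_eventually int \<open>R > 0\<close>)
  thus ?thesis
    by (simp add: sums_def contour_integral_sum int)
qed

lemma circlepath_integral_powi:
  assumes "R > 0"
  shows "contour_integral (circlepath 0 R) (\<lambda>w. w powi n) = (if n = -1 then 2 * of_real pi * \<i> else 0)"
proof (cases "n = -1")
  case True
  have "((\<lambda>w. 1 / (w - 0)) has_contour_integral 2 * of_real pi * \<i> * 1) (circlepath 0 R)"
    using \<open>R > 0\<close> by (intro Cauchy_integral_circlepath_simple) auto
  thus ?thesis
    using True by (simp add: contour_integral_unique power_int_minus divide_inverse)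
next
  case False
  have "((\<lambda>w. w powi n) has_contour_integral 0) (circlepath 0 R)"
  proof (rule Cauchy_theorem_primitive)
    show "((\<lambda>w. w powi (n + 1) / of_int (n + 1)) has_field_derivative w powi n) (at w within -{0})"
      if "w \<in> -{0}" for w :: complex
    proof -
      have "of_int (n + 1) \<noteq> (0 :: complex)"
        using False by (simp only: of_int_eq_0_iff) 
      moreover have "((\<lambda>w. w powi (n + 1)) has_field_derivative of_int (n + 1) * w powi n) (at w within -{0})"
        using that by (auto intro!: derivative_eq_intros)
      ultimately show ?thesis
        by (metis DERIV_cdivide nonzero_mult_div_cancel_left)
    qed
  qed (use \<open>R > 0\<close> in auto)
  thus ?thesis
    using False by (simp add: contour_integral_unique)
qed

text \<open>
  The radial segments between the two circles form a homotopy inside the closed annulus.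
\<close>

lemma circlepath_integral_deform:
  assumes "0 < \<rho>" "\<rho> \<le> R" and f: "f holomorphic_on S" and "open S"
    and ann: "\<And>w. \<rho> \<le> norm w \<Longrightarrow> norm w \<le> R \<Longrightarrow> w \<in> S"
  shows "contour_integral (circlepath 0 R) f = contour_integral (circlepath 0 \<rho>) f"
proof (rule Cauchy_theorem_homotopic_loops[OF _ \<open>open S\<close> f])
  show "homotopic_loops S (circlepath 0 R) (circlepath 0 \<rho>)"
  proof (rule homotopic_loops_linear)
    show "closed_segment (circlepath 0 R t) (circlepath 0 \<rho> t) \<subseteq> S" for t
    proof
      fix w assume "w \<in> closed_segment (circlepath 0 R t) (circlepath 0 \<rho> t)"
      then obtain u where u: "0 \<le> u" "u \<le> 1"
        and "w = of_real (1 - u) * (of_real R * exp (2 * of_real pi * \<i> * of_real t))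
               + of_real u * (of_real \<rho> * exp (2 * of_real pi * \<i> * of_real t))"
        by (auto simp: closed_segment_def circlepath scaleR_conv_of_real)
      hence "w = of_real ((1 - u) * R + u * \<rho>) * exp (2 * of_real pi * \<i> * of_real t)"
        by (simp add: algebra_simps)
      moreover have "norm (exp (2 * of_real pi * \<i> * complex_of_real t)) = 1"
        by (simp add: norm_exp_eq_Re)
      moreover have conv: "\<rho> \<le> (1 - u) * R + u * \<rho>" "(1 - u) * R + u * \<rho> \<le> R"
      proof -
        have "(1 - u) * \<rho> \<le> (1 - u) * R" "u * \<rho> \<le> u * R"
          using u assms(2) by (auto intro: mult_left_mono)
        thus "\<rho> \<le> (1 - u) * R + u * \<rho>" "(1 - u) * R + u * \<rho> \<le> R"
          by (simp_all add: algebra_simps)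
      qed
      ultimately have "norm w = (1 - u) * R + u * \<rho>"
        using \<open>0 < \<rho>\<close> by (simp only: norm_mult norm_of_real) simp
      thus "w \<in> S" using conv ann by simp
    qed
  qed (simp_all add: valid_path_imp_path)
qed auto

text \<open>
  Differentiation under the integral sign is legitimate on a ball around \<open>z0\<close> that misses the compact
  curve \<open>\<Psi> ` sphere 0 R\<close>.
\<close>

lemma Cauchy_type_integral_has_derivative:
  assumes "R > 0" and q: "continuous_on (sphere 0 R) q" and \<Psi>: "continuous_on (sphere 0 R) \<Psi>"
    and z0: "z0 \<notin> \<Psi> ` sphere 0 R"
  shows "((\<lambda>z. contour_integral (circlepath 0 R) (\<lambda>w. q w / (\<Psi> w - z))) has_field_derivative
           contour_integral (circlepath 0 R) (\<lambda>w. q w / (\<Psi> w - z0)\<^sup>2)) (at z0)"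
proof -
  have "compact (\<Psi> ` sphere 0 R)"
    by (intro compact_continuous_image \<Psi>) auto
  hence "open (- \<Psi> ` sphere 0 R)" by (simp add: compact_imp_closed open_Compl)
  then obtain e where e: "e > 0" "ball z0 e \<subseteq> - \<Psi> ` sphere 0 R"
    using z0 by (meson ComplI openE)
  define c where "c = (\<lambda>t. circlepath 0 R t)"
  define d where "d = (\<lambda>t. vector_derivative (circlepath 0 R) (at t))"
  have d: "continuous_on {0..1} d"
    unfolding d_def vector_derivative_circlepath by (intro continuous_intros)
  have c: "continuous_on {0..1} c"
    unfolding c_def circlepath by (intro continuous_intros)
  have c_sphere: "c t \<in> sphere 0 R" if "t \<in> {0..1}" for t
    using path_image_circlepath[of 0 R] that \<open>R > 0\<close> by (auto simp: path_image_def c_def)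
  have qc: "continuous_on {0..1} (\<lambda>t. q (c t))" and \<Psi>c: "continuous_on {0..1} (\<lambda>t. \<Psi> (c t))"
    using c_sphere by (auto intro!: continuous_on_compose2[OF q c] continuous_on_compose2[OF \<Psi> c])
  have ne: "\<Psi> (c t) - z \<noteq> 0" if "z \<in> ball z0 e" "t \<in> {0..1}" for z t
    using e that c_sphere by auto
  have "((\<lambda>z. integral (cbox 0 1) (\<lambda>t. q (c t) / (\<Psi> (c t) - z) * d t)) has_field_derivative
          integral (cbox 0 1) (\<lambda>t. q (c t) / (\<Psi> (c t) - z0)\<^sup>2 * d t)) (at z0 within ball z0 e)"
  proof (rule leibniz_rule_field_derivative)
    show "((\<lambda>z. q (c t) / (\<Psi> (c t) - z) * d t) has_field_derivative
             q (c t) / (\<Psi> (c t) - z)\<^sup>2 * d t) (at z within ball z0 e)"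
      if "z \<in> ball z0 e" "t \<in> cbox 0 1" for z t
      using ne[of z t] that
      by (auto intro!: derivative_eq_intros simp: power2_eq_square field_simps)
    show "(\<lambda>t. q (c t) / (\<Psi> (c t) - z) * d t) integrable_on cbox 0 1" if "z \<in> ball z0 e" for z
      using ne[OF that] by (intro integrable_continuous continuous_intros) (auto intro: qc \<Psi>c d)
    have "continuous_on (ball z0 e \<times> {0..1})
            (\<lambda>p. q (c (snd p)) / (\<Psi> (c (snd p)) - fst p)\<^sup>2 * d (snd p))"
      using ne
      by (intro continuous_intros continuous_on_compose2[OF qc] continuous_on_compose2[OF \<Psi>c]
            continuous_on_compose2[OF d]) auto
    thus "continuous_on (ball z0 e \<times> cbox 0 1) (\<lambda>(z, t). q (c t) / (\<Psi> (c t) - z)\<^sup>2 * d t)"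
      by (simp add: case_prod_unfold)
  qed (use \<open>e > 0\<close> in auto)
  thus ?thesis
    using \<open>e > 0\<close> by (simp add: contour_integral_integral c_def d_def at_within_open[of z0 "ball z0 e"])
qed

text \<open>
  Multiplying by \<open>w powi (k - 1)\<close> moves the coefficient of index \<open>k\<close> to the power \<open>-1\<close>, the only one with a non-zero
  integral. Convergence on all of \<open>\<bar>w\<bar> > \<gamma>\<close> is absolute and uniform on the circle of radius \<open>R\<close>, since it
  includes a circle strictly between the two radii.
\<close>

lemma laurent_coefficient_integral:
  assumes "0 < \<gamma>" "\<gamma> < R"
    and sums: "\<And>w. norm w > \<gamma> \<Longrightarrow> (\<lambda>m. b m * w powi (- int m)) sums f w"
  shows "contour_integral (circlepath 0 R) (\<lambda>w. w powi (k - 1) * f w) =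
           2 * of_real pi * \<i> * (if k \<ge> 0 then b (nat k) else 0)"
proof -
  have "R > 0" using assms by simp
  \<comment> \<open>Convergence at a point of modulus between \<open>\<gamma>\<close> and \<open>R\<close> forces absolute convergence at modulus \<open>R\<close>.\<close>
  define s :: complex where "s = of_real ((\<gamma> + R) / 2)"
  have "norm s > \<gamma>" "norm s < R" "s \<noteq> 0"
    using assms by (auto simp: s_def simp del: of_real_add of_real_divide)
  have "summable (\<lambda>m. b m * inverse s ^ m)"
    using sums[OF \<open>norm s > \<gamma>\<close>] by (auto simp: sums_iff power_int_minus power_inverse)
  hence absum: "summable (\<lambda>m. norm (b m * inverse (of_real R) ^ m))"
    by (rule powser_insidea)
       (use \<open>norm s < R\<close> \<open>s \<noteq> 0\<close> \<open>R > 0\<close> in \<open>auto simp: norm_inverse\<close>)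
  have "(\<lambda>m. contour_integral (circlepath 0 R) (\<lambda>w. w powi (k - 1) * (b m * w powi (- int m)))) sums
          contour_integral (circlepath 0 R) (\<lambda>w. w powi (k - 1) * f w)"
  proof (rule circlepath_integral_sums[OF \<open>R > 0\<close>])
    show "continuous_on (sphere 0 R) (\<lambda>w. w powi (k - 1) * (b m * w powi (- int m)))" for m
      using \<open>R > 0\<close> by (intro continuous_intros) auto
    show "norm (w powi (k - 1) * (b m * w powi (- int m)))
            \<le> R powi (k - 1) * norm (b m * inverse (of_real R) ^ m)" if "w \<in> sphere 0 R" for m w
      using that \<open>R > 0\<close>
      by (simp add: norm_mult norm_power_int norm_power norm_inverse power_int_minus power_inverse)
    show "summable (\<lambda>m. R powi (k - 1) * norm (b m * inverse (of_real R) ^ m))"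
      by (intro summable_mult absum)
    show "(\<lambda>m. w powi (k - 1) * (b m * w powi (- int m))) sums (w powi (k - 1) * f w)"
      if "w \<in> sphere 0 R" for w
      using that assms by (intro sums_mult sums) auto
  qed
  moreover have "contour_integral (circlepath 0 R) (\<lambda>w. w powi (k - 1) * (b m * w powi (- int m))) =
      (if int m = k then 2 * of_real pi * \<i> * b m else 0)" for m
  proof -
    have "contour_integral (circlepath 0 R) (\<lambda>w. w powi (k - 1) * (b m * w powi (- int m))) =
          contour_integral (circlepath 0 R) (\<lambda>w. b m * w powi (k - 1 - int m))"
    proof (rule contour_integral_cong)
      fix w assume "w \<in> path_image (circlepath 0 R)"
      hence "w \<noteq> 0" using \<open>R > 0\<close> by auto
      thus "w powi (k - 1) * (b m * w powi (- int m)) = b m * w powi (k - 1 - int m)"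
        using power_int_add[of w "k - 1" "- int m"] by simp
    qed auto
    also have "\<dots> = b m * contour_integral (circlepath 0 R) (\<lambda>w. w powi (k - 1 - int m))"
      using \<open>R > 0\<close>
      by (intro contour_integral_lmul circlepath_integrable_if_continuous continuous_intros) auto
    finally show ?thesis
      using circlepath_integral_powi[OF \<open>R > 0\<close>, of "k - 1 - int m"] by auto
  qed
  ultimately have 1: "(\<lambda>m. if int m = k then 2 * of_real pi * \<i> * b m else 0) sums
      contour_integral (circlepath 0 R) (\<lambda>w. w powi (k - 1) * f w)"
    by simp
  have 2: "(\<lambda>m. if int m = k then 2 * of_real pi * \<i> * b m else 0) sums
          (2 * of_real pi * \<i> * (if k \<ge> 0 then b (nat k) else 0))"
  proof (cases "k \<ge> 0")
    case True
    hence "int m = k \<longleftrightarrow> m = nat k" for m by auto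
    thus ?thesis
      using sums_single[of "nat k" "\<lambda>m. 2 * of_real pi * \<i> * b m"] True by simp
  next
    case False
    hence "int m \<noteq> k" for m by auto
    thus ?thesis using False by simp
  qed
  show ?thesis by (rule sums_unique2[OF 1 2])
qed

section \<open>Limits at the boundary\<close>

lemma isCont_imp_tendsto_within: "isCont f x \<Longrightarrow> (f \<longlongrightarrow> f x) (at x within S)"
  using continuous_at_imp_continuous_within[of x f S] by (simp add: continuous_within)

lemma isCont_C1_phi: "isCont (C1_phi \<gamma> F k) z"
  unfolding C1_phi_def by (cases "k > 0") (auto intro!: continuous_intros)

text \<open>
  Closeness to \<open>S\<close> as a set is weaker than closeness to one given point of \<open>S\<close>, so pointwise limits do not
  suffice in general. For compact \<open>S\<close> finitely many of the neighbourhoods supplied by the pointwise limits cover a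
  whole \<open>e\<close>-neighbourhood of \<open>S\<close>.
\<close>

lemma tendsto_approaching_compact:
  assumes "compact S" "A \<inter> S = {}" "S \<noteq> {}"
    and lim: "\<And>z0. z0 \<in> S \<Longrightarrow> (f \<longlongrightarrow> l) (at z0 within A)"
  shows "(f \<longlongrightarrow> l) (approaching S A)"
proof (rule topological_tendstoI)
  fix W assume W: "open W" "l \<in> W"
  have "\<exists>U. open U \<and> z0 \<in> U \<and> (\<forall>z\<in>U. z \<noteq> z0 \<longrightarrow> z \<in> A \<longrightarrow> f z \<in> W)" if "z0 \<in> S" for z0
    using topological_tendstoD[OF lim[OF that] W] unfolding eventually_at_topological .
  then obtain U where U_open: "\<And>x. x \<in> S \<Longrightarrow> open (U x)" and U_self: "\<And>x. x \<in> S \<Longrightarrow> x \<in> U x"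
    and U: "\<And>x z. x \<in> S \<Longrightarrow> z \<in> U x \<Longrightarrow> z \<noteq> x \<Longrightarrow> z \<in> A \<Longrightarrow> f z \<in> W"
    by metis
  obtain e where e: "e > 0" "(\<Union>x\<in>S. ball x e) \<subseteq> (\<Union>x\<in>S. U x)"
    by (rule compact_subset_open_imp_ball_epsilon_subset[OF \<open>compact S\<close>, of "\<Union>x\<in>S. U x"])
       (use U_open U_self in auto)
  have "f z \<in> W" if z: "z \<in> A" "infdist z S < e" for z
  proof -
    obtain x where "x \<in> S" "infdist z S = dist z x"
      using infdist_attains_inf[OF compact_imp_closed[OF \<open>compact S\<close>] \<open>S \<noteq> {}\<close>, of z] by blast
    with z have "z \<in> (\<Union>x\<in>S. ball x e)" by (auto simp: dist_commute)
    hence "z \<in> (\<Union>x\<in>S. U x)" using e(2) by (rule rev_subsetD)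
    then obtain y where "y \<in> S" "z \<in> U y" by blast
    moreover from this have "z \<noteq> y" using z assms(2) by auto
    ultimately show ?thesis using U z(1) by simp
  qed
  moreover have "eventually (\<lambda>x::real. x < e) (nhds 0)"
    using \<open>e > 0\<close> eventually_nhds_in_open[of "{..<e}" "0 :: real"] by simp
  ultimately show "eventually (\<lambda>z. f z \<in> W) (approaching S A)"
    unfolding approaching_def eventually_inf_principal eventually_filtercomap
    by (intro exI[of _ "\<lambda>x. x < e"] conjI allI impI) simp_all
qed

section \<open>The exterior map and its coordinate regions\<close>

text \<open>
  The circle \<open>\<bar>w\<bar> = r\<close> replaces the circle of radius \<open>\<gamma> - \<delta>\<close>: keeping \<open>r\<close> positive excludes the origin, where
  the reflection \<open>w \<mapsto> \<gamma>\<^sup>2 / cnj w\<close> is singular.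
\<close>

locale exterior_map_extended_inward =
  fixes \<Omega> :: "complex set" and \<gamma> r :: real and \<Psi> :: "complex \<Rightarrow> complex" and a :: "int \<Rightarrow> complex"
  assumes open_\<Omega>: "open \<Omega>" and connected_\<Omega>: "connected \<Omega>"
    and r_pos: "0 < r" and r_less: "r < \<gamma>"
    and hol: "\<Psi> holomorphic_on {w. r < norm w}" and inj: "inj_on \<Psi> {w. r < norm w}"
    and exterior: "\<Psi> ` {w. norm w > \<gamma>} = - closure \<Omega>"
    and frontier: "frontier \<Omega> = \<Psi> ` sphere 0 \<gamma>"
    and leading_coeff: "a (-1) = 1"
    and laurent: "norm w > \<gamma> \<Longrightarrow> (\<lambda>i. a (int i - 1) * w powi (- (int i - 1))) sums \<Psi> w"
begin

lemma \<gamma>_pos: "\<gamma> > 0"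
  using r_pos r_less by simp

lemma open_outer: "open {w::complex. s < norm w}"
  by (intro open_Collect_less continuous_intros)

lemma open_annulus: "open {w::complex. s < norm w \<and> norm w < R}"
  by (intro open_Collect_conj open_Collect_less continuous_intros)

lemma connected_annulus: "connected {w::complex. r < norm w \<and> norm w < R}"
proof -
  have "{w::complex. r < norm w \<and> norm w < R} = (\<lambda>(\<rho>, t). of_real \<rho> * cis t) ` ({r<..<R} \<times> UNIV)"
  proof (intro equalityI subsetI)
    fix w :: complex assume w: "w \<in> {w. r < norm w \<and> norm w < R}"
    have "w = (\<lambda>(\<rho>, t). of_real \<rho> * cis t) (norm w, Arg w)"
      using rcis_cmod_Arg[of w] by (simp add: rcis_def)
    thus "w \<in> (\<lambda>(\<rho>, t). of_real \<rho> * cis t) ` ({r<..<R} \<times> UNIV)"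
      using w by (intro image_eqI[of _ _ "(norm w, Arg w)"]) auto
  qed (use r_pos in \<open>auto simp: norm_mult\<close>)
  moreover have "connected ((\<lambda>(\<rho>, t). complex_of_real \<rho> * cis t) ` ({r<..<R} \<times> UNIV))"
    unfolding case_prod_unfold
    by (intro connected_continuous_image continuous_intros connected_Times) auto
  ultimately show ?thesis by simp
qed

lemma continuous_on_\<Psi>: "continuous_on {w. r < norm w} \<Psi>"
  by (rule holomorphic_on_imp_continuous_on[OF hol])

lemma deriv_hol: "deriv \<Psi> holomorphic_on {w. r < norm w}"
  by (intro holomorphic_deriv hol open_outer)

lemma deriv_nonzero: "r < norm w \<Longrightarrow> deriv \<Psi> w \<noteq> 0"
  by (rule holomorphic_injective_imp_regular[OF hol open_outer inj]) auto

lemma has_derivative_\<Psi>: "r < norm w \<Longrightarrow> (\<Psi> has_field_derivative deriv \<Psi> w) (at w)"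
  using hol open_outer by (intro holomorphic_derivI) auto

lemma \<Psi>_eqD: "\<Psi> v = \<Psi> w \<Longrightarrow> r < norm v \<Longrightarrow> r < norm w \<Longrightarrow> v = w"
  using inj by (auto dest: inj_onD)

text \<open>
  By injectivity such a point is neither in the exterior nor on the boundary, because these are exactly
  the images of \<open>\<bar>w\<bar> > \<gamma>\<close> and \<open>\<bar>w\<bar> = \<gamma>\<close>.
\<close>

lemma \<Psi>_inside:
  assumes "r < norm w" "norm w < \<gamma>"
  shows "\<Psi> w \<in> \<Omega>"
proof -
  have "\<Psi> w \<notin> \<Psi> ` {w. norm w > \<gamma>}" "\<Psi> w \<notin> \<Psi> ` sphere 0 \<gamma>"
    using assms r_less by (auto dest!: \<Psi>_eqD)
  hence "\<Psi> w \<in> closure \<Omega>" "\<Psi> w \<notin> frontier \<Omega>"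
    using exterior frontier by auto
  thus ?thesis by (simp add: frontier_def interior_open[OF open_\<Omega>])
qed

lemma \<Psi>_not_in_\<Omega>: "\<gamma> \<le> norm w \<Longrightarrow> \<Psi> w \<notin> \<Omega>"
proof -
  assume "\<gamma> \<le> norm w"
  then consider "norm w > \<gamma>" | "norm w = \<gamma>" by linarith
  thus ?thesis
  proof cases
    case 1
    hence "\<Psi> w \<in> - closure \<Omega>" using exterior by blast
    thus ?thesis using closure_subset by auto
  next
    case 2
    hence "\<Psi> w \<in> frontier \<Omega>" using frontier by auto
    thus ?thesis by (auto simp: frontier_def interior_open[OF open_\<Omega>])
  qed
qed

text \<open>
  For \<open>R > \<gamma>\<close> this is \<open>closure \<Omega>\<close> enlarged by the exterior collar \<open>\<gamma> < \<bar>w\<bar> < R\<close>. Writing it with the overlapping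
  two-sided collar \<open>r < \<bar>w\<bar> < R\<close> makes openness and connectedness immediate.
\<close>

definition region :: "real \<Rightarrow> complex set" where
  "region R = \<Omega> \<union> \<Psi> ` {w. r < norm w \<and> norm w < R}"

lemma open_region: "open (region R)"
proof -
  have "open (\<Psi> ` {w. r < norm w \<and> norm w < R})"
    by (intro open_mapping_thm3 open_annulus holomorphic_on_subset[OF hol] inj_on_subset[OF inj]) auto
  thus ?thesis by (simp add: region_def open_\<Omega> open_Un)
qed

lemma \<Omega>_subset_region: "\<Omega> \<subseteq> region R"
  by (simp add: region_def)

lemma \<Psi>_mem_region: "r < norm w \<Longrightarrow> norm w < R \<Longrightarrow> \<Psi> w \<in> region R"
  by (auto simp: region_def)

lemma frontier_subset_region: "\<gamma> < R \<Longrightarrow> frontier \<Omega> \<subseteq> region R"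
  using frontier r_less by (auto intro: \<Psi>_mem_region)

lemma \<Omega>_nonempty: "\<Omega> \<noteq> {}"
proof -
  have "\<Psi> (of_real ((r + \<gamma>) / 2)) \<in> \<Omega>"
    using r_pos r_less by (intro \<Psi>_inside) (auto simp del: of_real_add of_real_divide)
  thus ?thesis by auto
qed

lemma connected_region:
  assumes "\<gamma> < R"
  shows "connected (region R)"
  unfolding region_def
proof (rule connected_Un)
  show "connected (\<Psi> ` {w. r < norm w \<and> norm w < R})"
    by (intro connected_continuous_image connected_annulus continuous_on_subset[OF continuous_on_\<Psi>]) auto
  have "\<Psi> (of_real ((r + \<gamma>) / 2)) \<in> \<Omega>"
       "complex_of_real ((r + \<gamma>) / 2) \<in> {w. r < norm w \<and> norm w < R}"
    using r_pos r_less assms by (auto intro!: \<Psi>_inside simp del: of_real_add of_real_divide)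
  thus "\<Omega> \<inter> \<Psi> ` {w. r < norm w \<and> norm w < R} \<noteq> {}" by blast
qed (rule connected_\<Omega>)

lemma region_avoids:
  assumes "z \<in> region R" "\<gamma> < R" "R \<le> norm w"
  shows "\<Psi> w \<noteq> z"
  using assms \<Psi>_not_in_\<Omega>[of w] r_less \<Psi>_eqD[of w] by (auto simp: region_def)

lemma region_exterior_cases:
  assumes "z \<in> region R" "z \<in> - closure \<Omega>" "\<gamma> < R"
  obtains w where "\<gamma> < norm w" "norm w < R" "z = \<Psi> w"
proof -
  obtain w where w: "\<gamma> < norm w" "z = \<Psi> w"
    using assms(2) exterior by auto
  moreover have "norm w < R"
    using region_avoids[OF assms(1,3), of w] w(2) by (meson not_le)
  ultimately show ?thesis using that by blast
qed

lemma open_avoiding: "open {w. r < norm w \<and> \<Psi> w \<noteq> z}"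
proof -
  have "{w. r < norm w \<and> \<Psi> w \<noteq> z} = {w. r < norm w} \<inter> \<Psi> -` (- {z})" by auto
  thus ?thesis
    using continuous_open_preimage[OF continuous_on_\<Psi> open_outer, of "- {z}"] by auto
qed

text \<open>
  In the coordinate \<open>u = 1 / w\<close> the function \<open>u \<Psi> (1 / u)\<close> has a removable singularity at \<open>0\<close>. Its Taylor
  coefficients are determined near \<open>0\<close>, where they are the given Laurent coefficients of \<open>\<Psi>\<close>, and its Taylor series
  converges on every disc of holomorphy. This is how the series, given for \<open>\<bar>w\<bar> > \<gamma>\<close>, reaches down to \<open>\<bar>w\<bar> > r\<close>.
\<close>

lemma reciprocal_chart:
  obtains g where "g holomorphic_on ball 0 (1 / r)" "g 0 = 1"
    "\<And>u. u \<in> ball 0 (1 / r) \<Longrightarrow> u \<noteq> 0 \<Longrightarrow> g u = u * \<Psi> (1 / u)"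
    "\<And>u. u \<in> ball 0 (1 / r) \<Longrightarrow> (\<lambda>i. a (int i - 1) * u ^ i) sums g u"
proof -
  define g where "g = (\<lambda>u. if u = 0 then 1 else u * \<Psi> (1 / u))"
  have series: "(\<lambda>i. a (int i - 1) * u ^ i) sums g u" if u: "u \<in> ball 0 (1 / \<gamma>)" for u
  proof (cases "u = 0")
    case True
    thus ?thesis
      using powser_sums_zero[of "\<lambda>i. a (int i - 1)"] by (simp add: g_def leading_coeff)
  next
    case False
    have "norm (1 / u) > \<gamma>"
      using False u \<gamma>_pos by (simp add: norm_divide field_simps)
    from sums_mult[OF laurent[OF this], of u] have
      "(\<lambda>i. u * (a (int i - 1) * (1 / u) powi (- (int i - 1)))) sums g u"
      using False by (simp add: g_def)
    moreover have "u * (a (int i - 1) * (1 / u) powi (- (int i - 1))) = a (int i - 1) * u ^ i" for i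
    proof -
      have "(1 / u) powi (- (int i - 1)) = u powi (int i - 1)"
        using power_int_inverse[of u "int i - 1"] power_int_minus[of "1 / u" "int i - 1"]
        by (simp add: divide_inverse)
      thus ?thesis
        using False power_int_add[of u 1 "int i - 1"] by simp
    qed
    ultimately show ?thesis by (simp only:)
  qed
  have g0: "g holomorphic_on ball 0 (1 / \<gamma>)"
    using series by (intro power_series_holomorphic[of 0 _ "\<lambda>i. a (int i - 1)"]) simp
  have "(\<lambda>u. u * (\<Psi> \<circ> (\<lambda>u. 1 / u)) u) holomorphic_on ball 0 (1 / r) - {0}"
    using r_pos
    by (intro holomorphic_intros holomorphic_on_compose_gen[OF _ hol]) (auto simp: norm_divide field_simps)
  hence g1: "g holomorphic_on ball 0 (1 / r) - {0}"
    by (rule holomorphic_transform) (auto simp: g_def)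
  have "g holomorphic_on (ball 0 (1 / \<gamma>) \<union> (ball 0 (1 / r) - {0}))"
    by (intro holomorphic_on_Un g0 g1) (auto intro: open_Diff)
  moreover have "ball 0 (1 / \<gamma>) \<union> (ball 0 (1 / r) - {0}) = ball (0 :: complex) (1 / r)"
  proof -
    have "1 / \<gamma> < 1 / r" using r_pos r_less by (intro divide_strict_left_mono) auto
    thus ?thesis using \<gamma>_pos by auto
  qed
  ultimately have g: "g holomorphic_on ball 0 (1 / r)" by simp
  \<comment> \<open>The coefficients are identified on the small disc, then the expansion is used on the large one.\<close>
  define A where "A = Abs_fps (\<lambda>i. a (int i - 1))"
  have "eventually (\<lambda>u. (\<lambda>n. fps_nth A n * u ^ n) sums g u) (nhds 0)"
    using eventually_nhds_in_open[of "ball 0 (1 / \<gamma>)" "0 :: complex"] \<gamma>_pos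
    by (auto elim!: eventually_mono simp: A_def intro!: series)
  hence fps: "g has_fps_expansion A" by (rule has_fps_expansionI)
  have "(\<lambda>i. a (int i - 1) * u ^ i) sums g u" if "u \<in> ball 0 (1 / r)" for u
  proof -
    have "g holomorphic_on eball 0 (ereal (1 / r))" using g by simp
    from has_fps_expansion_imp_sums_complex[OF fps this, of u] that show ?thesis by (simp add: A_def)
  qed
  with g show ?thesis by (intro that[of g]) (auto simp: g_def)
qed

lemma laurent_extended:
  assumes "r < norm w"
  shows "(\<lambda>i. a (int i - 1) * w powi (- (int i - 1))) sums \<Psi> w"
    and "summable (\<lambda>i. norm (a (int i - 1) * w powi (- (int i - 1))))"
proof -
  obtain g where g: "\<And>u. u \<in> ball 0 (1 / r) \<Longrightarrow> u \<noteq> 0 \<Longrightarrow> g u = u * \<Psi> (1 / u)"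
    "\<And>u. u \<in> ball 0 (1 / r) \<Longrightarrow> (\<lambda>i. a (int i - 1) * u ^ i) sums g u"
    using reciprocal_chart by metis
  have "w \<noteq> 0" using assms r_pos by auto
  hence w: "w \<noteq> 0" "1 / w \<in> ball 0 (1 / r)"
    using assms r_pos by (simp_all add: norm_divide field_simps)
  have eq: "a (int i - 1) * w powi (- (int i - 1)) = w * (a (int i - 1) * (1 / w) ^ i)" for i
    using w power_int_add[of w 1 "- int i"] by (simp add: power_int_minus field_simps)
  show "(\<lambda>i. a (int i - 1) * w powi (- (int i - 1))) sums \<Psi> w"
    unfolding eq using sums_mult[OF g(2)[OF w(2)], of w] g(1)[OF w(2)] w by simp
  \<comment> \<open>An intermediate radius turns convergence into absolute convergence.\<close>
  obtain s where s: "r < s" "s < norm w" using dense[OF assms] by blast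
  have "summable (\<lambda>i. a (int i - 1) * of_real (1 / s) ^ i)"
    using g(2)[of "of_real (1 / s)"] s r_pos
    by (auto simp: sums_iff field_simps norm_divide simp del: of_real_divide)
  hence "summable (\<lambda>i. norm (a (int i - 1) * (1 / w) ^ i))"
    by (rule powser_insidea)
       (use s r_pos \<open>w \<noteq> 0\<close> in \<open>simp add: norm_divide divide_strict_left_mono\<close>)
  thus "summable (\<lambda>i. norm (a (int i - 1) * w powi (- (int i - 1))))"
    unfolding eq norm_mult[of w] by (rule summable_mult)
qed

lemma filterlim_\<Psi>_at_infinity: "filterlim \<Psi> at_infinity at_infinity"
proof -
  obtain g where g: "g holomorphic_on ball 0 (1 / r)" "g 0 = 1"
    "\<And>u. u \<in> ball 0 (1 / r) \<Longrightarrow> u \<noteq> 0 \<Longrightarrow> g u = u * \<Psi> (1 / u)"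
    using reciprocal_chart by metis
  have "isCont g 0"
    using holomorphic_on_imp_continuous_on[OF g(1)] r_pos
    by (simp add: continuous_on_eq_continuous_at)
  hence "((\<lambda>w. g (inverse w)) \<longlongrightarrow> 1) at_infinity"
    using isCont_tendsto_compose[OF _ tendsto_inverse_0, of g] g(2) by simp
  hence "filterlim (\<lambda>w. g (inverse w) * w) at_infinity at_infinity"
    by (rule tendsto_mult_filterlim_at_infinity) (auto intro: filterlim_ident)
  moreover have "eventually (\<lambda>w. g (inverse w) * w = \<Psi> w) at_infinity"
    unfolding eventually_at_infinity
  proof (intro exI allI impI)
    fix w :: complex assume "r + 1 \<le> norm w"
    hence "norm w > r" "w \<noteq> 0" using r_pos by auto
    hence "inverse w \<in> ball 0 (1 / r)"
      using r_pos by (simp add: inverse_eq_divide norm_divide divide_strict_left_mono)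
    thus "g (inverse w) * w = \<Psi> w" using g(3)[of "inverse w"] \<open>w \<noteq> 0\<close> by (simp add: field_simps)
  qed
  ultimately show ?thesis
    by (rule filterlim_cong[OF refl refl, THEN iffD1, rotated])
qed

section \<open>Cauchy integrals in the exterior coordinate\<close>

definition cauchy_transform :: "(complex \<Rightarrow> complex) \<Rightarrow> real \<Rightarrow> complex \<Rightarrow> complex" where
  "cauchy_transform q R z = contour_integral (circlepath 0 R) (\<lambda>w. q w / (\<Psi> w - z)) / (2 * of_real pi * \<i>)"

lemma continuous_on_sphere_\<Psi>: "r < R \<Longrightarrow> continuous_on (sphere 0 R) \<Psi>"
  by (rule continuous_on_subset[OF continuous_on_\<Psi>]) auto

lemma cauchy_transform_holomorphic:
  assumes "\<gamma> < R" "continuous_on (sphere 0 R) q"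
  shows "cauchy_transform q R holomorphic_on region R"
proof -
  have "cauchy_transform q R field_differentiable (at z)" if "z \<in> region R" for z
  proof -
    have "z \<notin> \<Psi> ` sphere 0 R"
    proof
      assume "z \<in> \<Psi> ` sphere 0 R"
      then obtain w where "z = \<Psi> w" "norm w = R" by auto
      thus False using region_avoids[OF that assms(1), of w] by simp
    qed
    from DERIV_cdivide[OF Cauchy_type_integral_has_derivative[OF _ assms(2) continuous_on_sphere_\<Psi> this],
        of "2 * of_real pi * \<i>"]
    show ?thesis
      using assms(1) r_less \<gamma>_pos unfolding field_differentiable_def cauchy_transform_def by auto
  qed
  thus ?thesis
    by (auto simp: holomorphic_on_def intro: field_differentiable_at_within)
qed

text \<open>
  For \<open>z \<in> \<Omega>\<close> the denominator \<open>\<Psi> w - z\<close> has no zero with \<open>\<bar>w\<bar> \<ge> \<gamma>\<close>.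
\<close>

lemma cauchy_transform_deform_interior:
  assumes "z \<in> \<Omega>" "\<gamma> < R" "R < R'" and q: "q holomorphic_on {w. r < norm w \<and> norm w < R'}"
  shows "cauchy_transform q \<gamma> z = cauchy_transform q R z"
proof -
  let ?S = "{w. r < norm w \<and> \<Psi> w \<noteq> z} \<inter> {w. r < norm w \<and> norm w < R'}"
  have "contour_integral (circlepath 0 R) (\<lambda>w. q w / (\<Psi> w - z)) =
        contour_integral (circlepath 0 \<gamma>) (\<lambda>w. q w / (\<Psi> w - z))"
  proof (rule circlepath_integral_deform)
    show "open ?S" by (intro open_Int open_avoiding open_annulus)
    show "(\<lambda>w. q w / (\<Psi> w - z)) holomorphic_on ?S"
      by (intro holomorphic_intros holomorphic_on_subset[OF q] holomorphic_on_subset[OF hol]) auto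
    show "w \<in> ?S" if "\<gamma> \<le> norm w" "norm w \<le> R" for w
      using that assms r_less \<Psi>_not_in_\<Omega>[of w] by auto
  qed (use assms \<gamma>_pos in auto)
  thus ?thesis by (simp add: cauchy_transform_def)
qed

text \<open>
  The simple pole at \<open>w0\<close> is subtracted by hand. With \<open>D\<close> the difference quotient of \<open>\<Psi>\<close> at \<open>w0\<close> and \<open>h = q / D\<close>,
  the integrand is \<open>h w / (w - w0)\<close>, that is a function \<open>H\<close> holomorphic on the annulus plus
  \<open>h w0 / (w - w0)\<close>. The first has the same integral over both circles; the second contributes only on the circle
  that encloses \<open>w0\<close>.
\<close>

lemma cauchy_transform_deform_exterior:
  assumes w0: "\<gamma> < norm w0" "norm w0 < R" and "R < R'"
    and q: "q holomorphic_on {w. r < norm w \<and> norm w < R'}"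
  shows "cauchy_transform q \<gamma> (\<Psi> w0) = cauchy_transform q R (\<Psi> w0) - q w0 / deriv \<Psi> w0"
proof -
  let ?A = "{w. r < norm w \<and> norm w < R'}"
  have w0A: "w0 \<in> ?A" using assms r_less by auto
  define D where "D = (\<lambda>w. if w = w0 then deriv \<Psi> w0 else (\<Psi> w - \<Psi> w0) / (w - w0))"
  define h where "h = (\<lambda>w. q w / D w)"
  define H where "H = (\<lambda>w. if w = w0 then deriv h w0 else (h w - h w0) / (w - w0))"
  have "D holomorphic_on ?A"
    unfolding D_def by (intro pole_lemma_open holomorphic_on_subset[OF hol] open_annulus) auto
  moreover have D_nz: "D w \<noteq> 0" if "r < norm w" for w
    using that deriv_nonzero[of w0] \<Psi>_eqD[of w w0] w0 r_less by (auto simp: D_def)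
  ultimately have "h holomorphic_on ?A"
    unfolding h_def by (intro holomorphic_intros q) auto
  hence H: "H holomorphic_on ?A"
    unfolding H_def by (intro pole_lemma_open open_annulus)
  have integral: "((\<lambda>w. q w / (\<Psi> w - \<Psi> w0)) has_contour_integral
        (contour_integral (circlepath 0 \<rho>) H + h w0 * I)) (circlepath 0 \<rho>)"
    if \<rho>: "r < \<rho>" "\<rho> < R'" "norm w0 \<noteq> \<rho>"
      and I: "((\<lambda>w. 1 / (w - w0)) has_contour_integral I) (circlepath 0 \<rho>)" for \<rho> I
  proof -
    have "\<rho> > 0" using r_pos \<rho> by simp
    have "H contour_integrable_on circlepath 0 \<rho>"
      using \<rho> \<open>\<rho> > 0\<close> by (intro circlepath_integrable_if_continuous
          continuous_on_subset[OF holomorphic_on_imp_continuous_on[OF H]]) auto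
    from has_contour_integral_add[OF has_contour_integral_integral[OF this]
        has_contour_integral_lmul[OF I, of "h w0"]]
    show ?thesis
    proof (rule has_contour_integral_eq)
      fix w assume "w \<in> path_image (circlepath 0 \<rho>)"
      hence "norm w = \<rho>" using \<open>\<rho> > 0\<close> by auto
      hence "w \<noteq> w0" "\<Psi> w \<noteq> \<Psi> w0" using \<rho> \<Psi>_eqD[of w w0] w0 r_less by auto
      hence "H w + h w0 * (1 / (w - w0)) = h w / (w - w0)"
        by (simp add: H_def diff_divide_distrib)
      also have "\<dots> = q w / (\<Psi> w - \<Psi> w0)"
        using \<open>w \<noteq> w0\<close> by (simp add: h_def D_def)
      finally show "H w + h w0 * (1 / (w - w0)) = q w / (\<Psi> w - \<Psi> w0)" .
    qed
  qed
  have "((\<lambda>w. 1 / (w - w0)) has_contour_integral 2 * of_real pi * \<i> * 1) (circlepath 0 R)"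
    using w0 by (intro Cauchy_integral_circlepath_simple) auto
  hence outer: "contour_integral (circlepath 0 R) (\<lambda>w. q w / (\<Psi> w - \<Psi> w0)) =
                contour_integral (circlepath 0 R) H + h w0 * (2 * of_real pi * \<i>)"
    using integral[of R "2 * of_real pi * \<i>"] w0 \<open>R < R'\<close> r_less by (simp add: contour_integral_unique)
  have "((\<lambda>w. 1 / (w - w0)) has_contour_integral 0) (circlepath 0 \<gamma>)"
    by (rule Cauchy_theorem_disc_simple[of _ 0 "norm w0"])
       (use w0 \<gamma>_pos in \<open>auto intro!: holomorphic_intros\<close>)
  hence inner: "contour_integral (circlepath 0 \<gamma>) (\<lambda>w. q w / (\<Psi> w - \<Psi> w0)) =
                contour_integral (circlepath 0 \<gamma>) H"
    using integral[of \<gamma> 0] w0 \<open>R < R'\<close> r_less by (simp add: contour_integral_unique)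
  have "contour_integral (circlepath 0 R) H = contour_integral (circlepath 0 \<gamma>) H"
    by (rule circlepath_integral_deform[OF _ _ H open_annulus])
       (use \<gamma>_pos w0 \<open>R < R'\<close> r_less in auto)
  moreover have "h w0 = q w0 / deriv \<Psi> w0" by (simp add: h_def D_def)
  ultimately show ?thesis
    using inner outer by (simp add: cauchy_transform_def field_simps)
qed

section \<open>The kernels of the two densities\<close>

text \<open>
  This kernel turns \<open>e\<^sup>i\<^sup>k\<^sup>\<theta> d\<theta>\<close> on \<open>\<bar>w\<bar> = \<gamma>\<close> into a holomorphic differential: there
  \<open>mode k w dw = \<i> e\<^sup>i\<^sup>k\<^sup>\<theta> d\<theta>\<close>.
\<close>

definition mode :: "int \<Rightarrow> complex \<Rightarrow> complex" where
  "mode k w = of_real \<gamma> powi (- k) * w powi (k - 1)"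

text \<open>
  The Schwarz function of the boundary curve, written in the coordinate \<open>w\<close>: the holomorphic continuation
  of \<open>cnj (\<Psi> w)\<close> off the circle of radius \<open>\<gamma>\<close>.
\<close>

definition schwarz :: "complex \<Rightarrow> complex" where
  "schwarz w = cnj (\<Psi> (of_real (\<gamma>\<^sup>2) / cnj w))"

lemma mode_holomorphic: "mode k holomorphic_on - {0}"
  unfolding mode_def by (intro holomorphic_intros) auto

lemma reflected_norm:
  assumes "w \<noteq> 0" "norm w < \<gamma>\<^sup>2 / r"
  shows "r < norm (of_real (\<gamma>\<^sup>2) / cnj w)"
  using assms r_pos by (simp add: norm_divide norm_power field_simps)

lemma schwarz_on_circle: "norm w = \<gamma> \<Longrightarrow> schwarz w = cnj (\<Psi> w)"
proof -
  assume "norm w = \<gamma>"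
  hence "of_real (\<gamma>\<^sup>2) = w * cnj w" by (metis complex_norm_square)
  moreover have "w \<noteq> 0" using \<open>norm w = \<gamma>\<close> \<gamma>_pos by auto
  ultimately show ?thesis by (simp add: schwarz_def)
qed

lemma schwarz_holomorphic: "schwarz holomorphic_on {w. 0 < norm w \<and> norm w < \<gamma>\<^sup>2 / r}"
proof -
  let ?B = "{w. 0 < norm w \<and> norm w < \<gamma>\<^sup>2 / r}"
  have "cnj ` ?B = ?B" by (auto simp: image_iff intro!: exI[of _ "cnj _"])
  have "(\<Psi> \<circ> (\<lambda>w. of_real (\<gamma>\<^sup>2) / w)) holomorphic_on cnj ` ?B"
  proof (rule holomorphic_on_compose_gen[OF _ hol])
    show "(\<lambda>w. of_real (\<gamma>\<^sup>2) / w) holomorphic_on cnj ` ?B"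
      by (intro holomorphic_intros) auto
    show "(\<lambda>w. of_real (\<gamma>\<^sup>2) / w) ` cnj ` ?B \<subseteq> {w. r < norm w}"
      using reflected_norm by auto
  qed
  hence "cnj \<circ> (\<Psi> \<circ> (\<lambda>w. of_real (\<gamma>\<^sup>2) / w)) \<circ> cnj holomorphic_on ?B"
    by (rule holomorphic_on_compose_cnj_cnj)
       (intro open_Collect_conj open_Collect_less continuous_intros)
  thus ?thesis by (simp add: o_def schwarz_def[abs_def])
qed

text \<open>
  The reflection \<open>w \<mapsto> \<gamma>\<^sup>2 / cnj w\<close> maps \<open>0 < \<bar>w\<bar> < \<gamma>\<^sup>2 / r\<close> into \<open>\<bar>w\<bar> > r\<close>, so the extended Laurent series applies
  at the reflected point; conjugating it gives a series in powers of \<open>w / \<gamma>\<^sup>2\<close>.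
\<close>

lemma schwarz_sums:
  assumes "w \<noteq> 0" "norm w < \<gamma>\<^sup>2 / r"
  shows "(\<lambda>i. cnj (a (int i - 1)) * (w / of_real (\<gamma>\<^sup>2)) powi (int i - 1)) sums schwarz w"
    and "summable (\<lambda>i. norm (cnj (a (int i - 1)) * (w / of_real (\<gamma>\<^sup>2)) powi (int i - 1)))"
proof -
  let ?v = "of_real (\<gamma>\<^sup>2) / cnj w"
  have eq: "cnj (a (int i - 1)) * (w / of_real (\<gamma>\<^sup>2)) powi (int i - 1) =
        cnj (a (int i - 1) * ?v powi (- (int i - 1)))" for i
  proof -
    have "?v powi (- (int i - 1)) = inverse ?v powi (int i - 1)"
      by (metis power_int_inverse power_int_minus)
    thus ?thesis by simp
  qed
  show "(\<lambda>i. cnj (a (int i - 1)) * (w / of_real (\<gamma>\<^sup>2)) powi (int i - 1)) sums schwarz w"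
    unfolding eq sums_cnj schwarz_def by (rule laurent_extended(1)[OF reflected_norm[OF assms]])
  show "summable (\<lambda>i. norm (cnj (a (int i - 1)) * (w / of_real (\<gamma>\<^sup>2)) powi (int i - 1)))"
    unfolding eq complex_mod_cnj by (rule laurent_extended(2)[OF reflected_norm[OF assms]])
qed

text \<open>
  This turns the series over the shifted indices \<open>k + j\<close> in the definition of \<open>conj_part\<close> into one multiple of the
  series of the Schwarz function.
\<close>

lemma mode_shift:
  assumes "w \<noteq> 0"
  shows "of_real \<gamma> powi (- j) * mode (k + j) w = mode k w * (w / of_real (\<gamma>\<^sup>2)) powi j"
proof -
  have "w powi (k + j - 1) = w powi (k - 1) * w powi j"
    using power_int_add[of w "k - 1" j] assms by (simp add: algebra_simps)
  moreover have "complex_of_real \<gamma> powi (- (k + j)) = of_real \<gamma> powi (- k) * of_real \<gamma> powi (- j)"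
    using power_int_add[of "complex_of_real \<gamma>" "- k" "- j"] \<gamma>_pos by simp
  moreover have "(w / of_real (\<gamma>\<^sup>2)) powi j = w powi j * (of_real \<gamma> powi (- j) * of_real \<gamma> powi (- j))"
    by (simp add: power2_eq_square power_int_divide_distrib power_int_mult_distrib power_int_minus
        power_int_inverse divide_inverse)
  ultimately show ?thesis by (simp add: mode_def)
qed

section \<open>Faber polynomials as Cauchy integrals\<close>

text \<open>
  The generating function expresses \<open>F\<^sub>k\<close> as a Cauchy integral with density \<open>w\<^sup>k \<Psi>' w\<close> (and shows that this integral
  vanishes for negative \<open>k\<close>). Its derivative in \<open>z\<close> has the integrand \<open>w\<^sup>k \<Psi>' w / (\<Psi> w - z)\<^sup>2\<close>, which differs from
  \<open>k w\<^sup>k\<^sup>-\<^sup>1 / (\<Psi> w - z)\<close> by the \<open>w\<close>-derivative of \<open>w\<^sup>k / (\<Psi> w - z)\<close>. Since the identity holds only after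
  multiplication by \<open>k\<close>, it says nothing about the integral for \<open>k = 0\<close>.
\<close>

lemma mode_cauchy_integral_times_index:
  assumes F: "faber_polynomials \<Omega> \<gamma> \<Psi> F" and "\<gamma> < R" and z: "z \<in> \<Omega>"
  shows "of_int k * contour_integral (circlepath 0 R) (\<lambda>w. w powi (k - 1) / (\<Psi> w - z)) =
           2 * of_real pi * \<i> * (if k \<ge> 0 then poly (pderiv (F (nat k))) z else 0)"
proof -
  have "R > 0" "r < R" using assms \<gamma>_pos r_less by auto
  let ?q = "\<lambda>w. w powi k * deriv \<Psi> w"
  have ne: "\<Psi> w \<noteq> x" if "norm w = R" "x \<in> \<Omega>" for w x
    using \<Psi>_not_in_\<Omega>[of w] that assms by auto
  have nz: "w \<noteq> 0" if "norm w = R" for w :: complex using that \<open>R > 0\<close> by auto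
  have cont_deriv: "continuous_on (sphere 0 R) (deriv \<Psi>)"
    using \<open>r < R\<close> by (intro continuous_on_subset[OF holomorphic_on_imp_continuous_on[OF deriv_hol]]) auto
  note cont = continuous_on_sphere_\<Psi>[OF \<open>r < R\<close>]
  have coeff: "contour_integral (circlepath 0 R) (\<lambda>w. ?q w / (\<Psi> w - x)) =
      2 * of_real pi * \<i> * (if k \<ge> 0 then poly (F (nat k)) x else 0)" if x: "x \<in> \<Omega>" for x
  proof -
    have "contour_integral (circlepath 0 R) (\<lambda>w. w powi (k - 1) * (w * deriv \<Psi> w / (\<Psi> w - x))) =
          2 * of_real pi * \<i> * (if k \<ge> 0 then poly (F (nat k)) x else 0)"
    proof (rule laurent_coefficient_integral[OF \<gamma>_pos \<open>\<gamma> < R\<close>])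
      have "x \<in> closure \<Omega>" using x closure_subset by blast
      thus "(\<lambda>m. poly (F m) x * w powi (- int m)) sums (w * deriv \<Psi> w / (\<Psi> w - x))"
        if "norm w > \<gamma>" for w using F that by (simp add: faber_polynomials_def)
    qed
    moreover have "contour_integral (circlepath 0 R) (\<lambda>w. w powi (k - 1) * (w * deriv \<Psi> w / (\<Psi> w - x))) =
          contour_integral (circlepath 0 R) (\<lambda>w. ?q w / (\<Psi> w - x))"
    proof (rule contour_integral_cong)
      fix w assume "w \<in> path_image (circlepath 0 R)"
      hence "w \<noteq> 0" using \<open>R > 0\<close> by auto
      thus "w powi (k - 1) * (w * deriv \<Psi> w / (\<Psi> w - x)) = ?q w / (\<Psi> w - x)"
        using power_int_add[of w "k - 1" 1] by simp
    qed auto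
    ultimately show ?thesis by simp
  qed
  have "z \<notin> \<Psi> ` sphere 0 R" using ne z by force
  \<comment> \<open>Two evaluations of the same derivative: under the integral sign, and of the polynomial.\<close>
  hence D1: "((\<lambda>x. contour_integral (circlepath 0 R) (\<lambda>w. ?q w / (\<Psi> w - x))) has_field_derivative
          contour_integral (circlepath 0 R) (\<lambda>w. ?q w / (\<Psi> w - z)\<^sup>2)) (at z)"
    by (intro Cauchy_type_integral_has_derivative cont continuous_intros cont_deriv \<open>R > 0\<close>)
       (use nz in auto)
  have D2: "((\<lambda>x. contour_integral (circlepath 0 R) (\<lambda>w. ?q w / (\<Psi> w - x))) has_field_derivative
      2 * of_real pi * \<i> * (if k \<ge> 0 then poly (pderiv (F (nat k))) z else 0)) (at z)"
  proof (rule has_field_derivative_transform_within_open[OF _ open_\<Omega> z])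
    show "((\<lambda>x. 2 * of_real pi * \<i> * (if k \<ge> 0 then poly (F (nat k)) x else 0)) has_field_derivative
      2 * of_real pi * \<i> * (if k \<ge> 0 then poly (pderiv (F (nat k))) z else 0)) (at z)"
      by (cases "k \<ge> 0") (auto intro!: derivative_eq_intros poly_DERIV)
  qed (simp add: coeff)
  \<comment> \<open>Integration by parts: the integral of an exact differential over a closed curve is \<open>0\<close>.\<close>
  have int1: "(\<lambda>w. w powi (k - 1) / (\<Psi> w - z)) contour_integrable_on circlepath 0 R"
    using ne z nz by (intro circlepath_integrable_if_continuous continuous_intros cont \<open>R > 0\<close>) auto
  have int2: "(\<lambda>w. ?q w / (\<Psi> w - z)\<^sup>2) contour_integrable_on circlepath 0 R"
    using ne z nz
    by (intro circlepath_integrable_if_continuous continuous_intros cont cont_deriv \<open>R > 0\<close>) auto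
  have "((\<lambda>w. of_int k * (w powi (k - 1) / (\<Psi> w - z)) - ?q w / (\<Psi> w - z)\<^sup>2) has_contour_integral 0)
          (circlepath 0 R)"
  proof (rule Cauchy_theorem_primitive)
    show "((\<lambda>w. w powi k / (\<Psi> w - z)) has_field_derivative
            (of_int k * (w powi (k - 1) / (\<Psi> w - z)) - ?q w / (\<Psi> w - z)\<^sup>2)) (at w within sphere 0 R)"
      if "w \<in> sphere 0 R" for w
    proof -
      have "(\<Psi> has_field_derivative deriv \<Psi> w) (at w within sphere 0 R)"
        using has_derivative_\<Psi>[of w] that \<open>r < R\<close> by (auto intro: has_field_derivative_at_within)
      moreover have "w \<noteq> 0" "\<Psi> w - z \<noteq> 0" using that nz ne z by auto
      ultimately show ?thesis
        by (auto intro!: derivative_eq_intros simp: power2_eq_square diff_divide_distrib)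
    qed
  qed (use \<open>R > 0\<close> in auto)
  moreover have "((\<lambda>w. of_int k * (w powi (k - 1) / (\<Psi> w - z)) - ?q w / (\<Psi> w - z)\<^sup>2) has_contour_integral
      (of_int k * contour_integral (circlepath 0 R) (\<lambda>w. w powi (k - 1) / (\<Psi> w - z))
        - contour_integral (circlepath 0 R) (\<lambda>w. ?q w / (\<Psi> w - z)\<^sup>2))) (circlepath 0 R)"
    by (intro has_contour_integral_diff has_contour_integral_lmul has_contour_integral_integral int1 int2)
  ultimately have "of_int k * contour_integral (circlepath 0 R) (\<lambda>w. w powi (k - 1) / (\<Psi> w - z)) =
      contour_integral (circlepath 0 R) (\<lambda>w. ?q w / (\<Psi> w - z)\<^sup>2)"
    using has_contour_integral_unique by fastforce
  with DERIV_unique[OF D1 D2] show ?thesis by simp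
qed

text \<open>
  The integral does not depend on the radius, and it tends to \<open>0\<close> as the radius grows because
  \<open>\<Psi> w - z\<close> tends to infinity.
\<close>

lemma zero_mode_cauchy_integral:
  assumes "\<gamma> < R" "z \<in> \<Omega>"
  shows "contour_integral (circlepath 0 R) (\<lambda>w. inverse w / (\<Psi> w - z)) = 0"
proof (rule ccontr)
  let ?f = "\<lambda>w. inverse w / (\<Psi> w - z)"
  let ?I = "contour_integral (circlepath 0 R) ?f"
  assume "?I \<noteq> 0"
  \<comment> \<open>If \<open>\<bar>\<Psi> w - z\<bar> \<ge> B\<close> on the circle, the integral is at most \<open>2\<pi> / B\<close>, half of its own modulus for this \<open>B\<close>.\<close>
  define B where "B = 4 * pi / norm ?I"
  have "B > 0" using \<open>?I \<noteq> 0\<close> by (simp add: B_def)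
  have "R > 0" using assms \<gamma>_pos by simp
  have "filterlim (\<lambda>w. \<Psi> w - z) at_infinity at_infinity"
    using tendsto_add_filterlim_at_infinity'[OF filterlim_\<Psi>_at_infinity tendsto_const[of "- z"]] by simp
  hence "eventually (\<lambda>w. B \<le> norm (\<Psi> w - z)) at_infinity"
    using \<open>B > 0\<close> by (simp add: filterlim_at_infinity[of 0])
  then obtain b where b: "\<And>w. b \<le> norm w \<Longrightarrow> B \<le> norm (\<Psi> w - z)"
    unfolding eventually_at_infinity by blast
  define s where "s = max b R"
  have "R \<le> s" "s > 0" using \<open>R > 0\<close> by (auto simp: s_def)
  have ne: "\<Psi> w \<noteq> z" if "R \<le> norm w" for w
    using \<Psi>_not_in_\<Omega>[of w] assms that by auto
  have "contour_integral (circlepath 0 s) ?f = ?I"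
  proof (rule circlepath_integral_deform)
    show "?f holomorphic_on {w. r < norm w \<and> \<Psi> w \<noteq> z}"
      using r_pos by (intro holomorphic_intros holomorphic_on_subset[OF hol]) auto
    show "w \<in> {w. r < norm w \<and> \<Psi> w \<noteq> z}" if "R \<le> norm w" for w
      using ne that assms r_less by auto
  qed (use \<open>R > 0\<close> \<open>R \<le> s\<close> open_avoiding in auto)
  moreover have "?f contour_integrable_on circlepath 0 s"
    using \<open>R \<le> s\<close> \<open>s > 0\<close> ne assms r_less
    by (intro circlepath_integrable_if_continuous continuous_intros continuous_on_sphere_\<Psi>) auto
  ultimately have "(?f has_contour_integral ?I) (circlepath 0 s)"
    using has_contour_integral_integral by metis
  moreover have "norm (?f w) \<le> 1 / (s * B)" if "norm (w - 0) = s" for w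
  proof -
    have "B \<le> norm (\<Psi> w - z)" using that by (intro b) (simp add: s_def)
    hence "s * B \<le> norm w * norm (\<Psi> w - z)" using that \<open>s > 0\<close> by simp
    hence "1 / (norm w * norm (\<Psi> w - z)) \<le> 1 / (s * B)"
      using \<open>s > 0\<close> \<open>B > 0\<close> by (intro frac_le) auto
    thus ?thesis by (simp add: norm_divide norm_mult norm_inverse divide_inverse mult.commute)
  qed
  ultimately have "norm ?I \<le> 1 / (s * B) * (2 * pi * s)"
    using \<open>s > 0\<close> \<open>B > 0\<close> by (intro has_contour_integral_bound_circlepath) auto
  also have "\<dots> = norm ?I / 2" using \<open>s > 0\<close> \<open>?I \<noteq> 0\<close> by (simp add: B_def field_simps)
  finally show False using \<open>?I \<noteq> 0\<close> by simp
qed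

text \<open>
  Both sides are holomorphic on the connected open set \<open>region R\<close>, so it is enough to compare them on \<open>\<Omega>\<close>, where the
  generating function is available.
\<close>

lemma C1_phi_eq_cauchy_transform:
  assumes F: "faber_polynomials \<Omega> \<gamma> \<Psi> F" and "\<gamma> < R" and z: "z \<in> region R"
  shows "C1_phi \<gamma> F k z = - cauchy_transform (mode k) R z"
proof (rule analytic_continuation_open[OF open_\<Omega> open_region \<Omega>_nonempty connected_region[OF \<open>\<gamma> < R\<close>]
      \<Omega>_subset_region _ _ _ z])
  have "R > 0" "r < R" using assms \<gamma>_pos r_less by auto
  have nz: "w \<noteq> 0" if "norm w = R" for w :: complex using that \<open>R > 0\<close> by auto
  show "(\<lambda>z. C1_phi \<gamma> F k z) holomorphic_on region R"
    unfolding C1_phi_def by (cases "k > 0") (auto intro!: holomorphic_intros)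
  show "(\<lambda>z. - cauchy_transform (mode k) R z) holomorphic_on region R"
    using nz \<open>\<gamma> < R\<close> by (intro holomorphic_intros cauchy_transform_holomorphic
       continuous_on_subset[OF holomorphic_on_imp_continuous_on[OF mode_holomorphic]]) auto
  show "C1_phi \<gamma> F k x = - cauchy_transform (mode k) R x" if x: "x \<in> \<Omega>" for x
  proof -
    let ?J = "contour_integral (circlepath 0 R) (\<lambda>w. w powi (k - 1) / (\<Psi> w - x))"
    have "(\<lambda>w. w powi (k - 1) / (\<Psi> w - x)) contour_integrable_on circlepath 0 R"
      using \<Psi>_not_in_\<Omega> x nz \<open>\<gamma> < R\<close>
      by (intro circlepath_integrable_if_continuous continuous_intros continuous_on_sphere_\<Psi> \<open>R > 0\<close> \<open>r < R\<close>)
         auto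
    hence T: "cauchy_transform (mode k) R x = of_real \<gamma> powi (- k) * ?J / (2 * of_real pi * \<i>)"
      using contour_integral_lmul[of "\<lambda>w. w powi (k - 1) / (\<Psi> w - x)" "circlepath 0 R" "of_real \<gamma> powi (- k)"]
      by (simp add: cauchy_transform_def mode_def)
    have J: "of_int k * ?J = 2 * of_real pi * \<i> * (if k \<ge> 0 then poly (pderiv (F (nat k))) x else 0)"
      by (rule mode_cauchy_integral_times_index[OF F \<open>\<gamma> < R\<close> x])
    have J0: "?J = 0" if "k = 0"
      using zero_mode_cauchy_integral[OF \<open>\<gamma> < R\<close> x] that by (simp add: power_int_minus)
    show ?thesis
    proof (cases "k > 0")
      case True
      have "?J = 2 * of_real pi * \<i> * poly (pderiv (F (nat k))) x / of_int k"
        using J True by (simp add: nonzero_eq_divide_eq mult.commute)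
      thus ?thesis using T True by (simp add: C1_phi_def)
    next
      case False
      hence "?J = 0" using J J0 by (cases "k = 0") auto
      thus ?thesis using T False by (simp add: C1_phi_def)
    qed
  qed
qed

text \<open>
  Summation and integration may be exchanged because the series of the Schwarz function converges absolutely
  and uniformly on the circle of radius \<open>R < \<gamma>\<^sup>2 / r\<close>. In particular the series defining \<open>conj_part\<close>
  converges on all of \<open>region R\<close>.
\<close>

lemma conj_part_C1_eq_cauchy_transform:
  assumes F: "faber_polynomials \<Omega> \<gamma> \<Psi> F" and R: "\<gamma> < R" "R < \<gamma>\<^sup>2 / r" and z: "z \<in> region R"
  shows "conj_part a \<gamma> (C1_phi \<gamma> F) k z = - cauchy_transform (\<lambda>w. mode k w * schwarz w) R z"
proof -
  have "R > 0" "r < R" using assms \<gamma>_pos r_less by auto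
  have nz: "w \<noteq> 0" if "norm w = R" for w :: complex using that \<open>R > 0\<close> by auto
  define e where "e = (\<lambda>w. mode k w / (\<Psi> w - z))"
  define c where "c = (\<lambda>i w. cnj (a (int i - 1)) * (w / of_real (\<gamma>\<^sup>2)) powi (int i - 1))"
  have ne: "\<Psi> w - z \<noteq> 0" if "norm w = R" for w
    using region_avoids[OF z R(1), of w] that by simp
  have cont_mode: "continuous_on (sphere 0 R) (mode j)" for j
    using nz by (intro continuous_on_subset[OF holomorphic_on_imp_continuous_on[OF mode_holomorphic]]) auto
  have e: "continuous_on (sphere 0 R) e"
    unfolding e_def using ne \<open>r < R\<close> by (intro continuous_intros continuous_on_sphere_\<Psi> cont_mode) auto
  have "compact (e ` sphere 0 R)" by (intro compact_continuous_image e) auto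
  then obtain M where M: "\<And>w. w \<in> sphere 0 R \<Longrightarrow> norm (e w) \<le> M"
    by (metis bounded_iff compact_imp_bounded imageI)
  have "(\<lambda>i. contour_integral (circlepath 0 R) (\<lambda>w. c i w * e w)) sums
          contour_integral (circlepath 0 R) (\<lambda>w. schwarz w * e w)"
  proof (rule circlepath_integral_sums[OF \<open>R > 0\<close>])
    show "continuous_on (sphere 0 R) (\<lambda>w. c i w * e w)" for i
      unfolding c_def using \<gamma>_pos nz by (intro continuous_intros e) auto
    show "norm (c i w * e w) \<le> norm (c i (of_real R)) * M" if "w \<in> sphere 0 R" for i w
    proof -
      have "norm (c i w) = norm (c i (of_real R))"
        using that \<open>R > 0\<close> by (simp add: c_def norm_mult norm_power_int norm_divide norm_power)
      thus ?thesis using M[OF that] by (simp add: norm_mult mult_left_mono)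
    qed
    show "summable (\<lambda>i. norm (c i (of_real R)) * M)"
      unfolding c_def by (intro summable_mult2 schwarz_sums(2)) (use R \<open>R > 0\<close> in auto)
    show "(\<lambda>i. c i w * e w) sums (schwarz w * e w)" if "w \<in> sphere 0 R" for w
      unfolding c_def by (intro sums_mult2 schwarz_sums(1)) (use R that nz in auto)
  qed
  hence "(\<lambda>i. - (contour_integral (circlepath 0 R) (\<lambda>w. c i w * e w) / (2 * of_real pi * \<i>))) sums
          (- (contour_integral (circlepath 0 R) (\<lambda>w. schwarz w * e w) / (2 * of_real pi * \<i>)))"
    by (intro sums_minus sums_divide)
  moreover have "contour_integral (circlepath 0 R) (\<lambda>w. schwarz w * e w) / (2 * of_real pi * \<i>) =
      cauchy_transform (\<lambda>w. mode k w * schwarz w) R z"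
    by (simp add: cauchy_transform_def e_def mult.commute)
  moreover have "- (contour_integral (circlepath 0 R) (\<lambda>w. c i w * e w) / (2 * of_real pi * \<i>)) =
      cnj (a (int i - 1)) * of_real \<gamma> powi (- (int i - 1)) * C1_phi \<gamma> F (k + (int i - 1)) z" for i
  proof -
    let ?j = "int i - 1"
    let ?b = "cnj (a ?j) * of_real \<gamma> powi (- ?j)"
    have "contour_integral (circlepath 0 R) (\<lambda>w. c i w * e w) =
          contour_integral (circlepath 0 R) (\<lambda>w. ?b * (mode (k + ?j) w / (\<Psi> w - z)))"
    proof (rule contour_integral_cong)
      fix w assume "w \<in> path_image (circlepath 0 R)"
      hence "w \<noteq> 0" using \<open>R > 0\<close> by auto
      from mode_shift[OF this, of ?j k]
      have "?b * mode (k + ?j) w = c i w * mode k w" by (simp add: c_def mult_ac)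
      thus "c i w * e w = ?b * (mode (k + ?j) w / (\<Psi> w - z))" by (simp add: e_def)
    qed auto
    also have "\<dots> = ?b * contour_integral (circlepath 0 R) (\<lambda>w. mode (k + ?j) w / (\<Psi> w - z))"
      using ne \<open>r < R\<close> \<open>R > 0\<close>
      by (intro contour_integral_lmul circlepath_integrable_if_continuous continuous_intros
            continuous_on_sphere_\<Psi> cont_mode) auto
    finally show ?thesis
      by (simp add: C1_phi_eq_cauchy_transform[OF F R(1) z] cauchy_transform_def)
  qed
  ultimately show ?thesis
    unfolding conj_part_def by (simp add: sums_iff)
qed

section \<open>The part carried by the crossed pole\<close>

lemma C2_phi_exterior:
  assumes "\<gamma> < norm w"
  shows "C2_phi \<Omega> \<gamma> \<Psi> k (\<Psi> w) = mode k w / deriv \<Psi> w"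
proof -
  have "inv_into {w. norm w > \<gamma>} \<Psi> (\<Psi> w) = w"
    using assms r_less by (intro inv_into_f_f inj_on_subset[OF inj]) auto
  moreover have "\<Psi> w \<in> - closure \<Omega>" using assms exterior by blast
  ultimately show ?thesis by (simp add: C2_phi_def mode_def)
qed

lemma conj_part_C2_exterior:
  assumes "\<gamma> < norm w" "norm w < \<gamma>\<^sup>2 / r"
  shows "conj_part a \<gamma> (C2_phi \<Omega> \<gamma> \<Psi>) k (\<Psi> w) = mode k w * schwarz w / deriv \<Psi> w"
proof -
  have "w \<noteq> 0" using assms \<gamma>_pos by auto
  have "cnj (a (int i - 1)) * of_real \<gamma> powi (- (int i - 1)) * C2_phi \<Omega> \<gamma> \<Psi> (k + (int i - 1)) (\<Psi> w) =
        mode k w / deriv \<Psi> w * (cnj (a (int i - 1)) * (w / of_real (\<gamma>\<^sup>2)) powi (int i - 1))" for i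
    using mode_shift[OF \<open>w \<noteq> 0\<close>, of "int i - 1" k]
    by (simp add: C2_phi_exterior[OF assms(1)] mult_ac)
  moreover have "(\<lambda>i. mode k w / deriv \<Psi> w * (cnj (a (int i - 1)) * (w / of_real (\<gamma>\<^sup>2)) powi (int i - 1)))
      sums (mode k w / deriv \<Psi> w * schwarz w)"
    by (intro sums_mult schwarz_sums(1) \<open>w \<noteq> 0\<close> assms(2))
  ultimately show ?thesis
    unfolding conj_part_def by (simp add: sums_iff)
qed

section \<open>Boundary integrals in the exterior coordinate\<close>

text \<open>
  The speed \<open>\<gamma> \<bar>\<Psi>'\<bar>\<close> of the boundary curve cancels the denominator of \<open>\<phi>\<^sub>k\<close>; what remains of the density is
  \<open>e\<^sup>i\<^sup>k\<^sup>\<theta> d\<theta>\<close>. The minus sign comes from \<open>z - \<zeta>\<close> against \<open>\<Psi> w - z\<close>.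
\<close>

lemma cauchy_op_weighted_basis_density:
  "cauchy_op \<gamma> \<Psi> (\<lambda>\<zeta>. m \<zeta> * basis_density \<gamma> \<Psi> k \<zeta>) z = - cauchy_transform (\<lambda>w. m (\<Psi> w) * mode k w) \<gamma> z"
proof -
  let ?f = "\<lambda>w. m (\<Psi> w) * mode k w / (\<Psi> w - z)"
  let ?e = "\<lambda>\<theta>. of_real \<gamma> * cis \<theta>"
  have pointwise: "m (\<Psi> (?e \<theta>)) * basis_density \<gamma> \<Psi> k (\<Psi> (?e \<theta>)) / (z - \<Psi> (?e \<theta>)) *
          of_real (norm (vector_derivative (bdry_curve \<gamma> \<Psi>) (at \<theta>))) =
        \<i> * (?f (0 + ?e \<theta>) * of_real \<gamma> * \<i> * cis \<theta>)" for \<theta>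
  proof -
    have norm_e: "norm (?e \<theta>) = \<gamma>" using \<gamma>_pos by (simp add: norm_mult)
    have "(?e has_vector_derivative of_real \<gamma> * (\<i> * cis \<theta>)) (at \<theta>)"
      unfolding cis_conv_exp by (auto intro!: derivative_eq_intros has_vector_derivative_real_field)
    moreover have "(\<Psi> has_field_derivative deriv \<Psi> (?e \<theta>)) (at (?e \<theta>))"
      using has_derivative_\<Psi> norm_e r_less by simp
    ultimately have "(\<Psi> \<circ> ?e has_vector_derivative of_real \<gamma> * (\<i> * cis \<theta>) * deriv \<Psi> (?e \<theta>)) (at \<theta>)"
      by (rule field_vector_diff_chain_at)
    moreover have "\<Psi> \<circ> ?e = bdry_curve \<gamma> \<Psi>" by (simp add: bdry_curve_def fun_eq_iff)
    ultimately have speed: "norm (vector_derivative (bdry_curve \<gamma> \<Psi>) (at \<theta>)) = \<gamma> * norm (deriv \<Psi> (?e \<theta>))"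
      using \<gamma>_pos by (simp add: vector_derivative_at norm_mult)
    have inv: "inv_into (sphere 0 \<gamma>) \<Psi> (\<Psi> (?e \<theta>)) = ?e \<theta>"
      using norm_e r_less by (intro inv_into_f_f inj_on_subset[OF inj]) auto
    have "Arg (?e \<theta>) = Arg (cis \<theta>)" using \<gamma>_pos by simp
    moreover have "cis (Arg (cis \<theta>)) = cis \<theta>"
      by (simp add: cis_Arg sgn_eq)
    ultimately have cis_Arg: "cis (Arg (?e \<theta>)) = cis \<theta>" by simp
    have "cis (of_int k * Arg (?e \<theta>)) = cis \<theta> powi k"
      by (metis cis_Arg cis_power_int)
    hence density: "basis_density \<gamma> \<Psi> k (\<Psi> (?e \<theta>)) = cis \<theta> powi k / (of_real (\<gamma> * norm (deriv \<Psi> (?e \<theta>))))"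
      by (simp add: basis_density_def inv scale_h_def Let_def cis_Arg)
    have "mode k (?e \<theta>) * (of_real \<gamma> * cis \<theta>) = cis \<theta> powi k"
    proof -
      have "?e \<theta> powi (k - 1) * ?e \<theta> = ?e \<theta> powi k"
        using power_int_add[of "?e \<theta>" "k - 1" 1] \<gamma>_pos by simp
      hence "mode k (?e \<theta>) * (of_real \<gamma> * cis \<theta>) = of_real \<gamma> powi (- k) * ?e \<theta> powi k"
        by (simp add: mode_def)
      also have "\<dots> = cis \<theta> powi k"
        using \<gamma>_pos by (simp add: power_int_mult_distrib power_int_minus)
      finally show ?thesis .
    qed
    moreover have "deriv \<Psi> (?e \<theta>) \<noteq> 0" using deriv_nonzero[of "?e \<theta>"] norm_e r_less by simp
    ultimately have numerator: "m (\<Psi> (?e \<theta>)) * basis_density \<gamma> \<Psi> k (\<Psi> (?e \<theta>)) *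
        of_real (norm (vector_derivative (bdry_curve \<gamma> \<Psi>) (at \<theta>))) =
        m (\<Psi> (?e \<theta>)) * mode k (?e \<theta>) * (of_real \<gamma> * cis \<theta>)"
      using \<gamma>_pos by (simp add: density speed)
    have rotate: "X / (z - \<zeta>) = \<i> * (X / (\<zeta> - z) * \<i>)" for X \<zeta>
    proof -
      have "\<i> * (Y * \<i>) = - Y" for Y by (simp add: complex_eq_iff)
      thus ?thesis using minus_divide_right[of X "\<zeta> - z"] by simp
    qed
    have "m (\<Psi> (?e \<theta>)) * basis_density \<gamma> \<Psi> k (\<Psi> (?e \<theta>)) / (z - \<Psi> (?e \<theta>)) *
          of_real (norm (vector_derivative (bdry_curve \<gamma> \<Psi>) (at \<theta>))) =
          m (\<Psi> (?e \<theta>)) * mode k (?e \<theta>) * (of_real \<gamma> * cis \<theta>) / (z - \<Psi> (?e \<theta>))"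
      unfolding numerator[symmetric] by simp
    also have "\<dots> = \<i> * (?f (0 + ?e \<theta>) * of_real \<gamma> * \<i> * cis \<theta>)"
      unfolding rotate by (simp add: mult_ac)
    finally show ?thesis .
  qed
  have "arclength_integral (bdry_curve \<gamma> \<Psi>) (\<lambda>\<zeta>. m \<zeta> * basis_density \<gamma> \<Psi> k \<zeta> / (z - \<zeta>)) =
        integral {0..2 * pi} (\<lambda>\<theta>. \<i> * (?f (0 + ?e \<theta>) * of_real \<gamma> * \<i> * cis \<theta>))"
    unfolding arclength_integral_def bdry_curve_def pointwise ..
  also have "\<dots> = \<i> * integral {0..2 * pi} (\<lambda>\<theta>. ?f (0 + ?e \<theta>) * of_real \<gamma> * \<i> * cis \<theta>)"
    by (rule integral_mult_right)
  finally have "cauchy_op \<gamma> \<Psi> (\<lambda>\<zeta>. m \<zeta> * basis_density \<gamma> \<Psi> k \<zeta>) z =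
        1 / (2 * of_real pi) * (\<i> * integral {0..2 * pi} (\<lambda>\<theta>. ?f (0 + ?e \<theta>) * of_real \<gamma> * \<i> * cis \<theta>))"
    by (simp only: cauchy_op_def)
  also have "\<dots> = 1 / (2 * of_real pi) * (\<i> * contour_integral (circlepath 0 \<gamma>) ?f)"
    unfolding circlepath_def by (subst contour_integral_part_circlepath_eq) auto
  also have "\<dots> = - cauchy_transform (\<lambda>w. m (\<Psi> w) * mode k w) \<gamma> z"
    by (simp add: cauchy_transform_def field_simps)
  finally show ?thesis .
qed

corollary cauchy_op_basis_density:
  "cauchy_op \<gamma> \<Psi> (basis_density \<gamma> \<Psi> k) z = - cauchy_transform (mode k) \<gamma> z"
  using cauchy_op_weighted_basis_density[of "\<lambda>_. 1"] by simp

corollary cauchy_op_cnj_basis_density: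
  "cauchy_op \<gamma> \<Psi> (\<lambda>\<zeta>. cnj \<zeta> * basis_density \<gamma> \<Psi> k \<zeta>) z = - cauchy_transform (\<lambda>w. mode k w * schwarz w) \<gamma> z"
proof -
  have "cauchy_transform (\<lambda>w. cnj (\<Psi> w) * mode k w) \<gamma> z = cauchy_transform (\<lambda>w. mode k w * schwarz w) \<gamma> z"
    unfolding cauchy_transform_def using \<gamma>_pos
    by (intro arg_cong[where f = "\<lambda>x. x / _"] contour_integral_cong) (auto simp: schwarz_on_circle)
  thus ?thesis by (simp add: cauchy_op_weighted_basis_density)
qed

section \<open>Boundary behaviour of the combinations\<close>

abbreviation combination :: "(int \<Rightarrow> complex \<Rightarrow> complex) \<Rightarrow> int \<Rightarrow> complex \<Rightarrow> complex" where
  "combination Cs k z \<equiv> - z * cnj (Cs k z) + cnj (conj_part a \<gamma> Cs k z)"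

abbreviation full_combination :: "int \<Rightarrow> complex \<Rightarrow> complex" where
  "full_combination k z \<equiv> - z * cnj (cauchy_op \<gamma> \<Psi> (basis_density \<gamma> \<Psi> k) z)
              + cnj (cauchy_op \<gamma> \<Psi> (\<lambda>\<zeta>. cnj \<zeta> * basis_density \<gamma> \<Psi> k \<zeta>) z)"

lemma \<gamma>_less_reflected_radius: "\<gamma> < \<gamma>\<^sup>2 / r"
  using r_pos r_less \<gamma>_pos by (simp add: field_simps power2_eq_square)

lemma mode_schwarz_holomorphic: "(\<lambda>w. mode k w * schwarz w) holomorphic_on {w. r < norm w \<and> norm w < \<gamma>\<^sup>2 / r}"
  using r_pos
  by (intro holomorphic_intros holomorphic_on_subset[OF mode_holomorphic]
        holomorphic_on_subset[OF schwarz_holomorphic]) auto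

lemma mode_holomorphic_annulus: "mode k holomorphic_on {w. r < norm w \<and> norm w < \<gamma>\<^sup>2 / r}"
  using r_pos by (intro holomorphic_on_subset[OF mode_holomorphic]) auto

lemma combination_C1_tendsto:
  assumes F: "faber_polynomials \<Omega> \<gamma> \<Psi> F" and z0: "z0 \<in> frontier \<Omega>"
  shows "(combination (C1_phi \<gamma> F) k \<longlongrightarrow> combination (C1_phi \<gamma> F) k z0) (at z0 within S)"
proof -
  obtain R where R: "\<gamma> < R" "R < \<gamma>\<^sup>2 / r" using dense[OF \<gamma>_less_reflected_radius] by blast
  have "continuous_on (sphere 0 R) (\<lambda>w. mode k w * schwarz w)"
    by (rule continuous_on_subset[OF holomorphic_on_imp_continuous_on[OF mode_schwarz_holomorphic]])
       (use R r_less in auto)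
  hence "(\<lambda>z. - cauchy_transform (\<lambda>w. mode k w * schwarz w) R z) holomorphic_on region R"
    by (intro holomorphic_intros cauchy_transform_holomorphic R)
  hence "conj_part a \<gamma> (C1_phi \<gamma> F) k holomorphic_on region R"
    by (rule holomorphic_transform) (simp add: conj_part_C1_eq_cauchy_transform[OF F R])
  hence "isCont (conj_part a \<gamma> (C1_phi \<gamma> F) k) z0"
    using holomorphic_on_imp_continuous_on[of _ "region R"] frontier_subset_region[OF R(1)] z0
    by (auto simp: continuous_on_eq_continuous_at[OF open_region])
  hence "isCont (combination (C1_phi \<gamma> F) k) z0" by (intro continuous_intros isCont_C1_phi)
  thus ?thesis by (rule isCont_imp_tendsto_within)
qed

lemma combination_C2_interior:
  assumes "z \<in> \<Omega>"
  shows "combination (C2_phi \<Omega> \<gamma> \<Psi>) k z = 0"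
proof -
  have "z \<in> closure \<Omega>" using assms closure_subset by blast
  thus ?thesis by (simp add: conj_part_def C2_phi_def)
qed

lemma combination_C2_exterior:
  assumes "\<gamma> < norm w" "norm w < \<gamma>\<^sup>2 / r"
  shows "combination (C2_phi \<Omega> \<gamma> \<Psi>) k (\<Psi> w) = cnj (mode k w / deriv \<Psi> w) * (cnj (schwarz w) - \<Psi> w)"
  by (simp add: C2_phi_exterior[OF assms(1)] conj_part_C2_exterior[OF assms] algebra_simps diff_divide_distrib)

text \<open>
  The formula in terms of \<open>w\<close> is continuous across the circle \<open>\<bar>w\<bar> = \<gamma>\<close> and vanishes on it, because
  \<open>cnj (S w) = \<Psi> w\<close> there. It is transported to the variable \<open>z\<close> by the continuous inverse of \<open>\<Psi>\<close>.
\<close>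

lemma combination_C2_tendsto_exterior:
  assumes z0: "z0 \<in> frontier \<Omega>"
  shows "(combination (C2_phi \<Omega> \<gamma> \<Psi>) k \<longlongrightarrow> 0) (at z0 within - closure \<Omega>)"
proof -
  let ?R = "\<gamma>\<^sup>2 / r"
  let ?A = "{w. r < norm w \<and> norm w < ?R}"
  let ?E = "\<lambda>w. cnj (mode k w / deriv \<Psi> w) * (cnj (schwarz w) - \<Psi> w)"
  obtain w0 where w0: "norm w0 = \<gamma>" "z0 = \<Psi> w0" using z0 frontier by auto
  obtain g where g: "g holomorphic_on \<Psi> ` {w. r < norm w}" "\<And>w. r < norm w \<Longrightarrow> g (\<Psi> w) = w"
    using holomorphic_has_inverse[OF hol open_outer inj] by (metis mem_Collect_eq)
  have "open (\<Psi> ` {w. r < norm w})" by (intro open_mapping_thm3 hol open_outer inj)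
  hence "isCont g z0"
    using holomorphic_on_imp_continuous_on[OF g(1)] w0 r_less
    by (auto simp: continuous_on_eq_continuous_at)
  have "continuous_on ?A ?E"
    using deriv_nonzero r_pos
    by (intro continuous_intros holomorphic_on_imp_continuous_on[OF mode_holomorphic_annulus]
         continuous_on_subset[OF continuous_on_\<Psi>]
         continuous_on_subset[OF holomorphic_on_imp_continuous_on[OF deriv_hol]]
         continuous_on_subset[OF holomorphic_on_imp_continuous_on[OF schwarz_holomorphic]]) auto
  hence "isCont ?E w0"
    using w0 r_less \<gamma>_less_reflected_radius by (simp add: continuous_on_eq_continuous_at[OF open_annulus])
  moreover have "g z0 = w0" using g(2) w0 r_less by simp
  ultimately have "isCont (?E \<circ> g) z0" using \<open>isCont g z0\<close> by (intro continuous_at_compose) simp_all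
  moreover have "(?E \<circ> g) z0 = 0" using \<open>g z0 = w0\<close> w0 by (simp add: schwarz_on_circle)
  ultimately have "((?E \<circ> g) \<longlongrightarrow> 0) (at z0 within - closure \<Omega>)"
    using isCont_imp_tendsto_within[of z0 "?E \<circ> g" "- closure \<Omega>"] by (simp only:)
  moreover have "eventually (\<lambda>z. (?E \<circ> g) z = combination (C2_phi \<Omega> \<gamma> \<Psi>) k z) (at z0 within - closure \<Omega>)"
  proof -
    have "z0 \<in> region ?R" using frontier_subset_region[OF \<gamma>_less_reflected_radius] z0 by blast
    hence "eventually (\<lambda>z. z \<in> region ?R) (at z0 within - closure \<Omega>)"
      by (auto simp: eventually_at_topological intro!: exI[of _ "region ?R"] open_region)
    moreover have "eventually (\<lambda>z. z \<in> - closure \<Omega>) (at z0 within - closure \<Omega>)"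
      by (simp add: eventually_at_filter)
    ultimately show ?thesis
    proof eventually_elim
      case (elim z)
      then obtain w where "\<gamma> < norm w" "norm w < ?R" "z = \<Psi> w"
        using region_exterior_cases[OF _ _ \<gamma>_less_reflected_radius] by blast
      thus ?case using combination_C2_exterior[of w k] g(2)[of w] r_less by simp
    qed
  qed
  ultimately show ?thesis by (rule Lim_transform_eventually)
qed

text \<open>
  The kernels are moved from the radius \<open>\<gamma>\<close> to the radius \<open>R\<close>; outside \<open>\<Omega>\<close> the two crossed poles together
  give exactly the \<open>C\<^sub>2\<close> combination.
\<close>

lemma full_eq_combination_sum:
  assumes F: "faber_polynomials \<Omega> \<gamma> \<Psi> F" and R: "\<gamma> < R" "R < \<gamma>\<^sup>2 / r"
    and z: "z \<in> region R" "z \<in> \<Omega> \<or> z \<in> - closure \<Omega>"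
  shows "full_combination k z = combination (C1_phi \<gamma> F) k z + combination (C2_phi \<Omega> \<gamma> \<Psi>) k z"
proof -
  note C1 = C1_phi_eq_cauchy_transform[OF F R(1) z(1)] conj_part_C1_eq_cauchy_transform[OF F R z(1)]
  note op = cauchy_op_basis_density cauchy_op_cnj_basis_density
  from z(2) show ?thesis
  proof
    assume "z \<in> \<Omega>"
    thus ?thesis
      using cauchy_transform_deform_interior[OF _ R mode_holomorphic_annulus, of z k]
        cauchy_transform_deform_interior[OF _ R mode_schwarz_holomorphic, of z k]
      by (simp only: C1 op combination_C2_interior) simp
  next
    assume "z \<in> - closure \<Omega>"
    then obtain w where w: "\<gamma> < norm w" "norm w < R" "z = \<Psi> w"
      using region_exterior_cases z(1) R(1) by blast
    have "norm w < \<gamma>\<^sup>2 / r" using w R by simp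
    show ?thesis
      unfolding w(3) combination_C2_exterior[OF w(1) \<open>norm w < \<gamma>\<^sup>2 / r\<close>] C1[unfolded w(3)] op
        cauchy_transform_deform_exterior[OF w(1,2) R(2) mode_holomorphic_annulus]
        cauchy_transform_deform_exterior[OF w(1,2) R(2) mode_schwarz_holomorphic]
      by (simp add: algebra_simps diff_divide_distrib)
  qed
qed

lemma full_tendsto:
  assumes F: "faber_polynomials \<Omega> \<gamma> \<Psi> F" and z0: "z0 \<in> frontier \<Omega>" and S: "S \<in> {\<Omega>, - closure \<Omega>}"
  shows "(full_combination k \<longlongrightarrow> combination (C1_phi \<gamma> F) k z0) (at z0 within S)"
proof -
  obtain R where R: "\<gamma> < R" "R < \<gamma>\<^sup>2 / r" using dense[OF \<gamma>_less_reflected_radius] by blast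
  have in_S: "eventually (\<lambda>z. z \<in> S) (at z0 within S)" by (simp add: eventually_at_filter)
  have "(combination (C2_phi \<Omega> \<gamma> \<Psi>) k \<longlongrightarrow> 0) (at z0 within S)"
  proof (cases "S = \<Omega>")
    case True
    have "eventually (\<lambda>z. 0 = combination (C2_phi \<Omega> \<gamma> \<Psi>) k z) (at z0 within S)"
      using in_S by eventually_elim (use True combination_C2_interior in auto)
    thus ?thesis using Lim_transform_eventually tendsto_const by fast
  next
    case False
    thus ?thesis using S combination_C2_tendsto_exterior[OF z0] by simp
  qed
  from tendsto_add[OF combination_C1_tendsto[OF F z0] this]
  have "((\<lambda>z. combination (C1_phi \<gamma> F) k z + combination (C2_phi \<Omega> \<gamma> \<Psi>) k z) \<longlongrightarrow> combination (C1_phi \<gamma> F) k z0) (at z0 within S)"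
    by simp
  moreover have "eventually (\<lambda>z. combination (C1_phi \<gamma> F) k z + combination (C2_phi \<Omega> \<gamma> \<Psi>) k z = full_combination k z) (at z0 within S)"
  proof -
    have "z0 \<in> region R" using frontier_subset_region[OF R(1)] z0 by blast
    hence "eventually (\<lambda>z. z \<in> region R) (at z0 within S)"
      by (auto simp: eventually_at_topological intro!: exI[of _ "region R"] open_region)
    with in_S show ?thesis
      by eventually_elim (use full_eq_combination_sum[OF F R] S in auto)
  qed
  ultimately show ?thesis by (rule Lim_transform_eventually)
qed

lemma combination_C2_approaching:
  assumes S: "S \<in> {\<Omega>, - closure \<Omega>}"
  shows "(combination (C2_phi \<Omega> \<gamma> \<Psi>) k \<longlongrightarrow> 0) (approaching (frontier \<Omega>) S)"
proof (cases "S = \<Omega>")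
  case True
  have "eventually (\<lambda>z. 0 = combination (C2_phi \<Omega> \<gamma> \<Psi>) k z) (approaching (frontier \<Omega>) S)"
    unfolding approaching_def eventually_inf_principal
    by (intro always_eventually allI impI) (use True combination_C2_interior in auto)
  thus ?thesis using Lim_transform_eventually tendsto_const by fast
next
  case False
  hence "S = - closure \<Omega>" using S by simp
  show ?thesis unfolding \<open>S = - closure \<Omega>\<close>
  proof (rule tendsto_approaching_compact)
    show "compact (frontier \<Omega>)"
      unfolding frontier by (intro compact_continuous_image continuous_on_sphere_\<Psi> r_less) auto
    show "- closure \<Omega> \<inter> frontier \<Omega> = {}" by (auto simp: frontier_def)
    show "frontier \<Omega> \<noteq> {}" unfolding frontier using \<gamma>_pos by simp
  qed (rule combination_C2_tendsto_exterior)
qed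

end

theorem lemma5p1:
  fixes \<Omega> :: "complex set" and \<gamma> \<delta> :: real and \<Psi> :: "complex \<Rightarrow> complex"
    and a :: "int \<Rightarrow> complex" and F :: "nat \<Rightarrow> complex poly" and k :: int
  assumes "open \<Omega>" and "\<Omega> \<noteq> {}" and "bounded \<Omega>" and "simply_connected \<Omega>" and "connected \<Omega>"
    and "\<gamma> > 0" and "\<delta> > 0"
    and "\<Psi> holomorphic_on {w. norm w > \<gamma> - \<delta>}" and "inj_on \<Psi> {w. norm w > \<gamma> - \<delta>}"
    and "\<Psi> ` {w. norm w > \<gamma>} = - closure \<Omega>"
    and "frontier \<Omega> = \<Psi> ` sphere 0 \<gamma>"
    and "a (-1) = 1"
    and "\<And>w. norm w > \<gamma> \<Longrightarrow> (\<lambda>i. a (int i - 1) * w powi (- (int i - 1))) sums \<Psi> w"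
    and "faber_polynomials \<Omega> \<gamma> \<Psi> F"
    and "k \<noteq> 0"
  defines "\<phi> \<equiv> basis_density \<gamma> \<Psi> k"
    and "C1 \<equiv> C1_phi \<gamma> F" and "C2 \<equiv> C2_phi \<Omega> \<gamma> \<Psi>"
  defines "full \<equiv> \<lambda>z. - z * cnj (cauchy_op \<gamma> \<Psi> \<phi> z) + cnj (cauchy_op \<gamma> \<Psi> (\<lambda>\<zeta>. cnj \<zeta> * \<phi> \<zeta>) z)"
    and "comb \<equiv> \<lambda>Cs z. - z * cnj (Cs k z) + cnj (conj_part a \<gamma> Cs k z)"
  shows "(\<forall>z0\<in>frontier \<Omega>. \<exists>L. (C1 k \<longlongrightarrow> L) (at z0 within - closure \<Omega>)
                            \<and> (C1 k \<longlongrightarrow> L) (at z0 within \<Omega>))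
       \<and> ((comb C2 \<longlongrightarrow> 0) (approaching (frontier \<Omega>) (- closure \<Omega>))
          \<and> (comb C2 \<longlongrightarrow> 0) (approaching (frontier \<Omega>) \<Omega>))
       \<and> (\<forall>z0\<in>frontier \<Omega>.
            (\<forall>S\<in>{\<Omega>, - closure \<Omega>}. (full \<longlongrightarrow> comb C1 z0) (at z0 within S)
                                  \<and> (comb C1 \<longlongrightarrow> comb C1 z0) (at z0 within S)))"
proof -
  obtain r where r: "max 0 (\<gamma> - \<delta>) < r" "r < \<gamma>"
    using dense[of "max 0 (\<gamma> - \<delta>)" \<gamma>] assms(6,7) by auto
  interpret exterior_map_extended_inward \<Omega> \<gamma> r \<Psi> a
  proof
    show "\<Psi> holomorphic_on {w. r < norm w}" "inj_on \<Psi> {w. r < norm w}"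
      using r by (auto intro: holomorphic_on_subset[OF assms(8)] inj_on_subset[OF assms(9)])
  qed (use assms r in auto)
  have C1_tendsto: "(C1 k \<longlongrightarrow> C1 k z0) (at z0 within S)" for z0 S
    unfolding C1_def by (intro isCont_imp_tendsto_within isCont_C1_phi)
  show ?thesis
  proof (intro conjI ballI)
    fix z0
    show "\<exists>L. (C1 k \<longlongrightarrow> L) (at z0 within - closure \<Omega>) \<and> (C1 k \<longlongrightarrow> L) (at z0 within \<Omega>)"
      using C1_tendsto by blast
  next
    show "(comb C2 \<longlongrightarrow> 0) (approaching (frontier \<Omega>) (- closure \<Omega>))"
      "(comb C2 \<longlongrightarrow> 0) (approaching (frontier \<Omega>) \<Omega>)"
      unfolding comb_def C2_def by (rule combination_C2_approaching; simp)+
  next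
    fix z0 S assume "z0 \<in> frontier \<Omega>" "S \<in> {\<Omega>, - closure \<Omega>}"
    thus "(full \<longlongrightarrow> comb C1 z0) (at z0 within S)"
      and "(comb C1 \<longlongrightarrow> comb C1 z0) (at z0 within S)"
      unfolding full_def comb_def C1_def \<phi>_def
      using full_tendsto[OF assms(14)] combination_C1_tendsto[OF assms(14)] by simp_all
  qed
qed

end
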